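(* Let $k_G^{\mathbb{C}} := 4/\pi$. Let $X$ be a complex $m\times n$ matrix with $\|X\|_c \leq 1$ and let $0 < \varepsilon < 1$. Then there exist a natural number $l$, a matrix $C \in M_{(m,l)}(\mathbb{C})$ with $$(1-\varepsilon)^2 I_m \leq CC^* \leq k_G^{\mathbb{C}} (1+\varepsilon)^2 I_m,$$ a matrix $Z^X \in M_{(l,n)}(\mathbb{T})$ such that $X = l^{-1/2}\, C Z^X$, and a matrix $Z^{I_m} \in M_{(l,m)}(\mathbb{T})$ such that $I_m = l^{-1/2}\, C Z^{I_m}$.
   Context: $M_{(m,l)}(\mathbb{C})$ denotes the complex $m\times l$ matrices; $\mathbb{T}$ is the unit circle in $\mathbb{C}$ and $M_{(l,n)}(\mathbb{T})$ is the set of $l\times n$ matrices with all entries in $\mathbb{T}$. $I_m$ is the $m\times m$ identity matrix and $A \leq B$ means $B - A$ is positive semidefinite. The column norm of $X$ is $\|X\|_c := \max_j \|X_j\|_2$, where $X_j$ is the $j$-th column of $X$ and $\|\cdot\|_2$ the Euclidean norm. *)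

theory Defs
  imports "Jordan_Normal_Form.Schur_Decomposition" "HOL-Analysis.L2_Norm"
begin

definition kGC :: real where
  "kGC = 4 / pi"

definition vec_l2_norm :: "complex vec \<Rightarrow> real" where
  "vec_l2_norm v = L2_set (\<lambda>i. cmod (v $ i)) {..<dim_vec v}"

(* Only meaningful if X has at least one column, since Max {} is unspecified. *)
definition col_norm :: "complex mat \<Rightarrow> real" where
  "col_norm X = Max ((\<lambda>j. vec_l2_norm (col X j)) ` {..<dim_col X})"

(* The order on complex is the one of Complex_Order:
   0 \<le> z says that z is real and nonnegative. *)
definition psd :: "complex mat \<Rightarrow> bool" where
  "psd A \<longleftrightarrow> square_mat A \<and> mat_adjoint A = A \<and>
     (\<forall>v \<in> carrier_vec (dim_row A). 0 \<le> (A *\<^sub>v v) \<bullet>c v)"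

(* The dimensions are compared explicitly: subtraction of matrices is total
   and takes its dimensions from the second argument. *)
definition loewner_le :: "complex mat \<Rightarrow> complex mat \<Rightarrow> bool"
    (infix "\<le>\<^sub>L" 50) where
  "A \<le>\<^sub>L B \<longleftrightarrow> dim_row A = dim_row B \<and> dim_col A = dim_col B \<and> psd (B - A)"

definition unimodular_mat :: "nat \<Rightarrow> nat \<Rightarrow> complex mat set" where
  "unimodular_mat l n = {Z \<in> carrier_mat l n. elements_mat Z \<subseteq> {z. cmod z = 1}}"

end

theory Submission
  imports "HOL-Probability.Distributions" "HOL-Probability.Infinite_Product_Measure" Defs
begin

unbundle no vec_syntax and no inner_syntax

text \<open>
  Put the columns of \<open>X\<close> and of the identity matrix into one family of vectors \<open>y\<^sub>j\<close> in
  \<open>\<complex>\<^sup>m\<close>, all of norm at most one. If \<open>C\<close> has the columns \<open>c\<^sub>k / sqrt l\<close>, and \<open>Z\<close> has the rows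
  \<open>z\<^sub>k\<close>, then \<open>l\<close> to the power \<open>-1/2\<close> times \<open>C Z\<close> is the average of the rank-one matrices
  \<open>c\<^sub>k z\<^sub>k\<close> over \<open>k < l\<close>, and \<open>C C*\<close> is the average of the \<open>c\<^sub>k c\<^sub>k*\<close>. Treating both families
  of columns at once makes one matrix \<open>C\<close> serve \<open>X\<close> and the identity. What has to be found is
  a finite list of pairs \<open>(c, z)\<close> with unimodular \<open>z\<close> for which the average of \<open>c z(j)\<close> is
  exactly \<open>y\<^sub>j\<close> and the average of \<open>c c*\<close> is nearly \<open>4 / \<pi>\<close> times the identity.

  A Gaussian random pair does this in the mean. Let \<open>g\<close> be a vector of independent complex
  Gaussians, with independent standard normal real and imaginary parts, so that
  \<open>E \<bar>g\<^sub>i\<bar>\<^sup>2 = 2\<close>. A linear form \<open>u = \<Sum> a\<^sub>i g\<^sub>i\<close> has \<open>E \<bar>u\<bar> = \<kappa> \<parallel>a\<parallel>\<close> with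
  \<open>\<kappa> = sqrt (\<pi> / 2)\<close> (\<open>cgauss_norm\<close>). Differentiating this identity in \<open>a\<close> at a unit vector
  yields \<open>E (cnj (sgn u) g\<^sub>i) = \<kappa> cnj a\<^sub>i\<close> (\<open>cgauss_phase_expectation\<close>). Therefore
  \<open>c = g / \<kappa>\<close> and \<open>z(j) = cnj (sgn (\<Sum> cnj y\<^sub>j\<^sub>i g\<^sub>i))\<close> have the mean \<open>E (c z(j)) = y\<^sub>j\<close>, and
  \<open>E (c c*)\<close> is \<open>2 / \<kappa>\<^sup>2 = 4 / \<pi>\<close> times the identity. A vector \<open>y\<^sub>j\<close> of norm below one is
  first completed to a unit vector by one more coordinate, which \<open>c\<close> then forgets.

  A finite sample reproduces these finitely many means up to any given error
  (\<open>ex_sample_close_to_expectations\<close>). The averages of \<open>c z(j)\<close> become exact after a small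
  number of pairs is added, each couple of which changes the sum of the \<open>c z(j)\<close> for one
  index \<open>j\<close> only (\<open>column_bump\<close>, \<open>ex_exact_averages\<close>). The sample is repeated so often that
  the added pairs disturb the average of \<open>c c*\<close> by an arbitrarily small amount, which together
  with the sampling error is absorbed by \<open>\<epsilon>\<close>. The lower bound holds because \<open>1 \<le> 4 / \<pi>\<close>.
\<close>

section \<open>Real Gaussian vectors\<close>

definition std_normal :: "real measure" where
  "std_normal = density lborel std_normal_density"

definition gauss :: "'i set \<Rightarrow> ('i \<Rightarrow> real) measure" where
  "gauss I = PiM I (\<lambda>_. std_normal)"

lemma prob_space_std_normal: "prob_space std_normal"
  unfolding std_normal_def by (rule prob_space_normal_density) simp

lemma sets_std_normal [measurable_cong, simp]: "sets std_normal = sets borel"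
  by (simp add: std_normal_def)

lemma prob_space_gauss: "prob_space (gauss I)"
  unfolding gauss_def by (intro prob_space_PiM prob_space_std_normal)

lemma measurable_gauss_component:
  "i \<in> I \<Longrightarrow> (\<lambda>\<omega>. \<omega> i) \<in> borel_measurable (gauss I)"
  unfolding gauss_def by measurable

lemma distributed_gauss_component:
  assumes "i \<in> I"
  shows "distributed (gauss I) lborel (\<lambda>\<omega>. \<omega> i) std_normal_density"
proof -
  have "distr (gauss I) std_normal (\<lambda>\<omega>. \<omega> i) = std_normal"
    unfolding gauss_def using assms by (intro distr_PiM_component prob_space_std_normal)
  moreover have "distr (gauss I) std_normal (\<lambda>\<omega>. \<omega> i) = distr (gauss I) lborel (\<lambda>\<omega>. \<omega> i)"
    by (intro distr_cong) auto
  ultimately show ?thesis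
    using assms by (simp add: distributed_def std_normal_def measurable_gauss_component)
qed

lemma indep_gauss_components:
  assumes "I \<noteq> {}"
  shows "prob_space.indep_vars (gauss I) (\<lambda>_. std_normal) (\<lambda>i \<omega>. \<omega> i) I"
proof -
  interpret prob_space "gauss I" by (rule prob_space_gauss)
  have "distr (gauss I) (\<Pi>\<^sub>M i\<in>I. std_normal) (\<lambda>\<omega>. \<lambda>i\<in>I. \<omega> i) =
      distr (gauss I) (gauss I) (\<lambda>\<omega>. \<omega>)"
    by (intro distr_cong) (auto simp: gauss_def space_PiM)
  moreover have "(\<Pi>\<^sub>M i\<in>I. distr (gauss I) std_normal (\<lambda>\<omega>. \<omega> i)) = gauss I"
    unfolding gauss_def
    by (intro PiM_cong refl distr_PiM_component prob_space_std_normal)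
  ultimately show ?thesis
    using assms by (subst indep_vars_iff_distr_eq_PiM')
      (auto simp: measurable_gauss_component measurable_cong_sets[OF refl sets_std_normal])
qed

text \<open>
  A sum of independent centred normal variables is normal, and the variances add. Writing the
  law as the image of the standard normal law under a scaling, and not as a normal density, also
  covers the zero form.
\<close>

lemma distr_gauss_linear_form:
  fixes a :: "'i \<Rightarrow> real"
  assumes "finite I"
  shows "distr (gauss I) borel (\<lambda>\<omega>. \<Sum>i\<in>I. a i * \<omega> i) =
    distr std_normal borel (\<lambda>x. sqrt (\<Sum>i\<in>I. (a i)\<^sup>2) * x)"
proof -
  interpret prob_space "gauss I" by (rule prob_space_gauss)
  interpret N: prob_space std_normal by (rule prob_space_std_normal)
  \<comment> \<open>The summation theorem for normal variables asks for positive variances, so the vanishing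
    coefficients are removed first.\<close>
  define J where "J = {i \<in> I. a i \<noteq> 0}"
  define \<sigma> where "\<sigma> = sqrt (\<Sum>i\<in>J. (a i)\<^sup>2)"
  have J: "finite J" "J \<subseteq> I" using assms by (auto simp: J_def)
  have \<sigma>: "sqrt (\<Sum>i\<in>I. (a i)\<^sup>2) = \<sigma>"
    unfolding \<sigma>_def using assms by (intro arg_cong[of _ _ sqrt] sum.mono_neutral_right) (auto simp: J_def)
  have form: "(\<lambda>\<omega>. \<Sum>i\<in>I. a i * \<omega> i) = (\<lambda>\<omega>. \<Sum>i\<in>J. a i * \<omega> i)"
    using assms by (intro ext sum.mono_neutral_right) (auto simp: J_def)
  show ?thesis
  proof (cases "J = {}")
    case True
    then have "\<sigma> = 0" by (simp add: \<sigma>_def)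
    have "distr (gauss I) borel (\<lambda>\<omega>. 0::real) = return borel 0"
      "distr std_normal borel (\<lambda>\<omega>. 0::real) = return borel 0"
      by (simp_all add: distr_const N.distr_const)
    with True \<open>\<sigma> = 0\<close> show ?thesis unfolding \<sigma> form by simp
  next
    case False
    have "0 < \<sigma>"
      using False J by (auto simp: \<sigma>_def J_def intro!: sum_pos)
    have "indep_vars (\<lambda>_. std_normal) (\<lambda>i \<omega>. \<omega> i) J"
      using indep_gauss_components[of I] J False by (auto intro: indep_vars_subset)
    then have ind: "indep_vars (\<lambda>_. borel) (\<lambda>i \<omega>. a i * \<omega> i) J"
      by (rule indep_vars_compose2[where Y = "\<lambda>i x. a i * x" and X = "\<lambda>i \<omega>. \<omega> i"])
        (simp add: measurable_cong_sets[OF sets_std_normal refl])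
    have nrm: "distributed (gauss I) lborel (\<lambda>\<omega>. a i * \<omega> i) (normal_density 0 \<bar>a i\<bar>)" if "i \<in> J" for i
    proof -
      have "i \<in> I" "a i \<noteq> 0" using that by (auto simp: J_def)
      then show ?thesis
        using normal_density_affine[where X = "\<lambda>\<omega>. \<omega> i" and \<mu> = 0 and \<sigma> = 1 and \<alpha> = "a i" and \<beta> = 0]
          distributed_gauss_component[of i I] by simp
    qed
    have "distributed (gauss I) lborel (\<lambda>\<omega>. \<Sum>i\<in>J. a i * \<omega> i) (normal_density 0 \<sigma>)"
    proof -
      have "0 < \<bar>a i\<bar>" if "i \<in> J" for i using that by (simp add: J_def)
      from sum_indep_normal[OF J(1) False ind this nrm]
      show ?thesis by (simp add: \<sigma>_def)
    qed
    then have D: "distributed (gauss I) lborel (\<lambda>\<omega>. (\<Sum>i\<in>J. a i * \<omega> i) / \<sigma>) std_normal_density"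
      using normal_standard_normal_convert[OF \<open>0 < \<sigma>\<close>, of _ 0] by simp
    have "distr std_normal borel (\<lambda>x. \<sigma> * x) =
        distr (distr (gauss I) lborel (\<lambda>\<omega>. (\<Sum>i\<in>J. a i * \<omega> i) / \<sigma>)) borel (\<lambda>x. \<sigma> * x)"
      using distributed_distr_eq_density[OF D] by (simp add: std_normal_def)
    also have "\<dots> = distr (gauss I) borel (\<lambda>\<omega>. \<Sum>i\<in>J. a i * \<omega> i)"
    proof -
      have "(\<lambda>x. \<sigma> * x) \<in> lborel \<rightarrow>\<^sub>M borel" by simp
      from distr_distr[OF this distributed_measurable[OF D]] show ?thesis
        using \<open>0 < \<sigma>\<close> by (simp add: o_def)
    qed
    finally show ?thesis unfolding \<sigma> form ..
  qed
qed

lemma has_bochner_integral_gauss_linear_form: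
  fixes a :: "'i \<Rightarrow> real" and h :: "real \<Rightarrow> real"
  assumes "finite I" "h \<in> borel_measurable borel"
    and "has_bochner_integral lborel (\<lambda>x. std_normal_density x * h (sqrt (\<Sum>i\<in>I. (a i)\<^sup>2) * x)) r"
  shows "has_bochner_integral (gauss I) (\<lambda>\<omega>. h (\<Sum>i\<in>I. a i * \<omega> i)) r"
proof -
  define \<sigma> where "\<sigma> = sqrt (\<Sum>i\<in>I. (a i)\<^sup>2)"
  have \<sigma>: "(\<lambda>x. \<sigma> * x) \<in> borel_measurable std_normal"
    by measurable
  have form: "(\<lambda>\<omega>. \<Sum>i\<in>I. a i * \<omega> i) \<in> borel_measurable (gauss I)"
    by (intro borel_measurable_sum borel_measurable_times borel_measurable_const measurable_gauss_component)
  have "has_bochner_integral std_normal (\<lambda>x. h (\<sigma> * x)) r"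
    unfolding std_normal_def
  proof (rule has_bochner_integral_density)
    have "(\<lambda>x. \<sigma> * x) \<in> borel_measurable lborel" by simp
    from measurable_compose[OF this assms(2)]
    show "(\<lambda>x. h (\<sigma> * x)) \<in> borel_measurable lborel" .
  qed (use assms(3) in \<open>simp_all add: \<sigma>_def\<close>)
  then have "has_bochner_integral (distr (gauss I) borel (\<lambda>\<omega>. \<Sum>i\<in>I. a i * \<omega> i)) h r"
    unfolding distr_gauss_linear_form[OF assms(1)] \<sigma>_def[symmetric]
    by (intro has_bochner_integral_distr[OF assms(2) \<sigma>])
  then show ?thesis
    by (simp add: has_bochner_integral_iff integrable_distr_eq[OF form assms(2)] integral_distr[OF form assms(2)])
qed

lemma gauss_abs_linear_form:
  fixes a :: "'i \<Rightarrow> real"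
  assumes "finite I"
  shows "has_bochner_integral (gauss I) (\<lambda>\<omega>. \<bar>\<Sum>i\<in>I. a i * \<omega> i\<bar>)
    (sqrt (2 / pi) * sqrt (\<Sum>i\<in>I. (a i)\<^sup>2))"
proof -
  define \<sigma> where "\<sigma> = sqrt (\<Sum>i\<in>I. (a i)\<^sup>2)"
  have "0 \<le> \<sigma>" by (simp add: \<sigma>_def sum_nonneg)
  have "has_bochner_integral lborel (\<lambda>x. \<sigma> * (std_normal_density x * \<bar>x\<bar>)) (\<sigma> * sqrt (2 / pi))"
    using has_bochner_integral_mult_right[OF std_normal_moment_abs_odd[of 0], of \<sigma>] by simp
  also have "(\<lambda>x. \<sigma> * (std_normal_density x * \<bar>x\<bar>)) = (\<lambda>x. std_normal_density x * \<bar>\<sigma> * x\<bar>)"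
    using \<open>0 \<le> \<sigma>\<close> by (auto simp: abs_mult)
  finally show ?thesis
    using has_bochner_integral_gauss_linear_form[OF assms, of abs a] by (simp add: \<sigma>_def mult.commute)
qed

lemma gauss_linear_form_even_power:
  fixes a :: "'i \<Rightarrow> real"
  assumes "finite I"
  shows "has_bochner_integral (gauss I) (\<lambda>\<omega>. (\<Sum>i\<in>I. a i * \<omega> i) ^ (2 * k))
    ((\<Sum>i\<in>I. (a i)\<^sup>2) ^ k * (fact (2 * k) / (2 ^ k * fact k)))"
proof -
  define \<sigma> where "\<sigma> = sqrt (\<Sum>i\<in>I. (a i)\<^sup>2)"
  have \<sigma>: "\<sigma> ^ (2 * k) = (\<Sum>i\<in>I. (a i)\<^sup>2) ^ k" 
    unfolding \<sigma>_def power_mult by (subst real_sqrt_pow2) (auto intro: sum_nonneg)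
  have "has_bochner_integral lborel (\<lambda>x. \<sigma> ^ (2 * k) * (std_normal_density x * x ^ (2 * k)))
    (\<sigma> ^ (2 * k) * (fact (2 * k) / (2 ^ k * fact k)))"
    by (intro has_bochner_integral_mult_right std_normal_moment_even)
  also have "(\<lambda>x. \<sigma> ^ (2 * k) * (std_normal_density x * x ^ (2 * k))) =
      (\<lambda>x. std_normal_density x * (\<sigma> * x) ^ (2 * k))"
    by (auto simp: power_mult_distrib)
  finally have "has_bochner_integral lborel (\<lambda>x. std_normal_density x * (\<sigma> * x) ^ (2 * k))
    (\<sigma> ^ (2 * k) * (fact (2 * k) / (2 ^ k * fact k)))" .
  from has_bochner_integral_gauss_linear_form[OF assms _ this[unfolded \<sigma>_def]]
  show ?thesis by (simp add: \<sigma>[unfolded \<sigma>_def])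
qed

section \<open>Complex Gaussian vectors and the mean modulus of a linear form\<close>

definition cgauss :: "'i \<Rightarrow> ('i \<times> bool \<Rightarrow> real) \<Rightarrow> complex" where
  "cgauss i \<omega> = Complex (\<omega> (i, True)) (\<omega> (i, False))"

lemma measurable_cgauss:
  assumes "i \<in> J"
  shows "cgauss i \<in> borel_measurable (gauss (J \<times> UNIV))"
proof -
  have "cgauss i = (\<lambda>\<omega>. of_real (\<omega> (i, True)) + \<i> * of_real (\<omega> (i, False)))"
    by (auto simp: cgauss_def complex_eq_iff)
  moreover have "(\<lambda>\<omega>. of_real (\<omega> (i, b)) :: complex) \<in> borel_measurable (gauss (J \<times> UNIV))" for b
    using measurable_compose[OF measurable_gauss_component[of "(i, b)" "J \<times> UNIV"] borel_measurable_of_real] assms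
    by simp
  ultimately show ?thesis
    by (simp only:) (intro borel_measurable_add borel_measurable_times borel_measurable_const)
qed

lemma measurable_cgauss_linear_form:
  "(\<lambda>\<omega>. \<Sum>i\<in>J. a i * cgauss i \<omega>) \<in> borel_measurable (gauss (J \<times> UNIV))"
  by (intro borel_measurable_sum borel_measurable_times borel_measurable_const measurable_cgauss)

text \<open>
  The real part of a complex linear form is a real linear form of the same norm in twice as many
  variables, so the moments of real forms carry over.
\<close>

lemma Re_cgauss_linear_form:
  assumes "finite J"
  shows "Re (\<Sum>i\<in>J. a i * cgauss i \<omega>) =
      (\<Sum>p\<in>J \<times> UNIV. (if snd p then Re (a (fst p)) else - Im (a (fst p))) * \<omega> p)"
    and "(\<Sum>p\<in>J \<times> UNIV. (if snd p then Re (a (fst p)) else - Im (a (fst p)))\<^sup>2) = (\<Sum>i\<in>J. (cmod (a i))\<^sup>2)"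
  by (simp_all add: sum.cartesian_product' UNIV_bool cgauss_def cmod_power2 add.commute)

lemma cgauss_abs_Re:
  assumes "finite J"
  shows "has_bochner_integral (gauss (J \<times> UNIV)) (\<lambda>\<omega>. \<bar>Re (\<Sum>i\<in>J. a i * cgauss i \<omega>)\<bar>)
    (sqrt (2 / pi) * sqrt (\<Sum>i\<in>J. (cmod (a i))\<^sup>2))"
  unfolding Re_cgauss_linear_form(1)[OF assms] Re_cgauss_linear_form(2)[OF assms, symmetric]
  using assms by (intro gauss_abs_linear_form) simp

lemma cgauss_Re_even_power:
  assumes "finite J"
  shows "has_bochner_integral (gauss (J \<times> UNIV)) (\<lambda>\<omega>. Re (\<Sum>i\<in>J. a i * cgauss i \<omega>) ^ (2 * k))
    ((\<Sum>i\<in>J. (cmod (a i))\<^sup>2) ^ k * (fact (2 * k) / (2 ^ k * fact k)))"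
  unfolding Re_cgauss_linear_form(1)[OF assms] Re_cgauss_linear_form(2)[OF assms, symmetric]
  using assms by (intro gauss_linear_form_even_power) simp

text \<open>
  Averaging \<open>\<bar>Im (cis (- t) u)\<bar>\<close> over the angle recovers \<open>\<bar>u\<bar>\<close> up to a constant. Half a turn
  suffices because the integrand has period \<open>\<pi>\<close>, and with \<open>p\<close> the argument of \<open>u\<close> (taken in
  the upper half-plane) the sine of \<open>p - t\<close> changes its sign only at \<open>t = p\<close>.
\<close>

lemma integral_abs_Im_rotated:
  "((\<lambda>t. \<bar>cos t * Im u - sin t * Re u\<bar>) has_integral 2 * cmod u) {0..pi}"
proof -
  have nonneg: "((\<lambda>t. \<bar>cos t * Im u - sin t * Re u\<bar>) has_integral 2 * cmod u) {0..pi}"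
    if "0 \<le> Im u" for u
  proof -
    define p where "p = Arg u"
    have p: "0 \<le> p" "p \<le> pi"
      using that Arg_bounded[of u] unfolding p_def by (auto simp: Arg_less_0)
    have "u = of_real (cmod u) * cis p"
      by (cases "u = 0") (simp_all add: p_def Arg_eq cis_conv_exp)
    then have u: "Re u = cmod u * cos p" "Im u = cmod u * sin p"
      by (metis Re_complex_of_real Im_complex_of_real times_complex.sel cis.sel mult_zero_left diff_zero add_0_right)+
    have form: "cos t * Im u - sin t * Re u = cmod u * sin (p - t)" for t
      unfolding u sin_diff by (simp add: algebra_simps)
    have "((\<lambda>t. \<bar>cmod u * sin (p - t)\<bar>) has_integral cmod u * cos (p - p) - cmod u * cos (p - 0)) {0..p}"
    proof (rule has_integral_eq[rotated], rule fundamental_theorem_of_calculus)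
      show "((\<lambda>t. cmod u * cos (p - t)) has_vector_derivative cmod u * sin (p - t)) (at t within {0..p})" for t
        by (auto intro!: derivative_eq_intros simp flip: has_real_derivative_iff_has_vector_derivative)
      show "cmod u * sin (p - t) = \<bar>cmod u * sin (p - t)\<bar>" if "t \<in> {0..p}" for t
        using that p sin_ge_zero[of "p - t"] by (simp add: abs_mult)
    qed (use p in auto)
    moreover have "((\<lambda>t. \<bar>cmod u * sin (p - t)\<bar>) has_integral - (cmod u * cos (p - pi)) - (- (cmod u * cos (p - p)))) {p..pi}"
    proof (rule has_integral_eq[rotated], rule fundamental_theorem_of_calculus)
      show "((\<lambda>t. - (cmod u * cos (p - t))) has_vector_derivative - (cmod u * sin (p - t))) (at t within {p..pi})" for t
        by (auto intro!: derivative_eq_intros simp flip: has_real_derivative_iff_has_vector_derivative)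
      show "- (cmod u * sin (p - t)) = \<bar>cmod u * sin (p - t)\<bar>" if "t \<in> {p..pi}" for t
        using that p sin_ge_zero[of "t - p"] sin_minus[of "t - p"] by (simp add: abs_mult)
    qed (use p in auto)
    ultimately have "((\<lambda>t. \<bar>cmod u * sin (p - t)\<bar>) has_integral
        cmod u * cos (p - p) - cmod u * cos (p - 0) +
        (- (cmod u * cos (p - pi)) - (- (cmod u * cos (p - p))))) {0..pi}"
      using p by (intro has_integral_combine[of 0 p pi])
    then show ?thesis
      unfolding form by (simp add: cos_diff)
  qed
  show ?thesis
  proof (cases "0 \<le> Im u")
    case False
    then have "((\<lambda>t. \<bar>cos t * Im (- u) - sin t * Re (- u)\<bar>) has_integral 2 * cmod (- u)) {0..pi}"
      by (intro nonneg) simp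
    moreover have "\<bar>cos t * Im (- u) - sin t * Re (- u)\<bar> = \<bar>cos t * Im u - sin t * Re u\<bar>" for t
      by simp
    ultimately show ?thesis by simp
  qed (rule nonneg)
qed

text \<open>
  This reduces to the real case: \<open>\<bar>u\<bar>\<close> is half the integral over \<open>t\<close> of
  \<open>\<bar>Im (cis (- t) u)\<bar>\<close>, and for each \<open>t\<close> the latter is the absolute value of a real Gaussian
  form of the same norm. Exchanging the two integrals by Tonelli's theorem gives the constant
  \<open>(\<pi> / 2) sqrt (2 / \<pi>) = sqrt (\<pi> / 2)\<close>.
\<close>

lemma cgauss_norm:
  assumes "finite J"
  shows "has_bochner_integral (gauss (J \<times> UNIV)) (\<lambda>\<omega>. cmod (\<Sum>i\<in>J. a i * cgauss i \<omega>))
    (sqrt (pi / 2) * sqrt (\<Sum>i\<in>J. (cmod (a i))\<^sup>2))"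
proof -
  define G where "G = gauss (J \<times> (UNIV :: bool set))"
  interpret prob_space G unfolding G_def by (rule prob_space_gauss)
  interpret pair_sigma_finite G lborel ..
  define u where "u \<omega> = (\<Sum>i\<in>J. a i * cgauss i \<omega>)" for \<omega>
  define r where "r = sqrt (2 / pi) * sqrt (\<Sum>i\<in>J. (cmod (a i))\<^sup>2)"
  have r: "0 \<le> r" by (simp add: r_def sum_nonneg)
  have u [measurable]: "u \<in> borel_measurable G"
    unfolding u_def G_def by (rule measurable_cgauss_linear_form)
  define F where "F = (\<lambda>(\<omega>, t). indicator {0..pi} t * ennreal \<bar>cos t * Im (u \<omega>) - sin t * Re (u \<omega>)\<bar>)"
  have F: "F \<in> borel_measurable (G \<Otimes>\<^sub>M lborel)"
    unfolding F_def by measurable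
  have inner: "(\<integral>\<^sup>+\<omega>. F (\<omega>, t) \<partial>G) = indicator {0..pi} t * ennreal r" for t
  proof -
    have "cos t * Im (u \<omega>) - sin t * Re (u \<omega>) = Re (\<Sum>i\<in>J. (- \<i> * cis (- t) * a i) * cgauss i \<omega>)" for \<omega>
    proof -
      have "(\<Sum>i\<in>J. (- \<i> * cis (- t) * a i) * cgauss i \<omega>) = - \<i> * cis (- t) * u \<omega>"
        unfolding u_def sum_distrib_left by (intro sum.cong) (auto simp: mult_ac)
      then show ?thesis by simp
    qed
    then have "has_bochner_integral G (\<lambda>\<omega>. \<bar>cos t * Im (u \<omega>) - sin t * Re (u \<omega>)\<bar>) r"
      using cgauss_abs_Re[OF assms, of "\<lambda>i. - \<i> * cis (- t) * a i"]
      by (simp add: G_def r_def norm_mult)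
    then have "(\<integral>\<^sup>+\<omega>. ennreal \<bar>cos t * Im (u \<omega>) - sin t * Re (u \<omega>)\<bar> \<partial>G) = ennreal r"
      by (subst nn_integral_eq_integral) (auto simp: has_bochner_integral_iff)
    then show ?thesis
      unfolding F_def by (simp add: nn_integral_cmult)
  qed
  have outer: "(\<integral>\<^sup>+t. F (\<omega>, t) \<partial>lborel) = ennreal (2 * cmod (u \<omega>))" for \<omega>
    unfolding F_def prod.case
    using nn_integral_has_integral_lebesgue[OF _ integral_abs_Im_rotated[of "u \<omega>"]]
    by (simp add: ennreal_mult' ennreal_indicator)
  have "(\<integral>\<^sup>+\<omega>. ennreal (2 * cmod (u \<omega>)) \<partial>G) = (\<integral>\<^sup>+t. indicator {0..pi} t * ennreal r \<partial>lborel)"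
    using Fubini'[of "\<lambda>\<omega> t. F (\<omega>, t)"] F unfolding inner outer by simp
  also have "\<dots> = ennreal (pi * r)"
    using r by (simp add: nn_integral_multc ennreal_mult)
  finally have "has_bochner_integral G (\<lambda>\<omega>. 2 * cmod (u \<omega>)) (pi * r)"
    using r by (intro has_bochner_integral_nn_integral) auto
  then have "has_bochner_integral G (\<lambda>\<omega>. (1 / 2) * (2 * cmod (u \<omega>))) ((1 / 2) * (pi * r))"
    by (rule has_bochner_integral_mult_right)
  moreover have "(1 / 2) * (pi * r) = sqrt (pi / 2) * sqrt (\<Sum>i\<in>J. (cmod (a i))\<^sup>2)"
  proof -
    have "pi / 2 * sqrt (2 / pi) = sqrt (pi / 2)"
      using real_sqrt_mult[of "pi / 2" "pi / 2"] by (simp add: real_sqrt_divide field_simps)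
    then show ?thesis by (simp add: r_def)
  qed
  ultimately show ?thesis by (simp add: G_def u_def)
qed

section \<open>Correlation of a Gaussian vector with the phase of a linear form\<close>

text \<open>
  The complex sign; its value at the origin is chosen so that the function is unimodular.
\<close>

definition phase :: "complex \<Rightarrow> complex" where
  "phase z = (if z = 0 then 1 else sgn z)"

lemma norm_phase [simp]: "cmod (phase z) = 1"
  by (simp add: phase_def norm_sgn)

lemma cnj_phase_mult_self: "cnj (phase z) * z = of_real (cmod z)"
proof (cases "z = 0")
  case False
  have "cnj (phase z) * z = (z * cnj z) / of_real (cmod z)"
    using False by (simp add: phase_def sgn_div_norm scaleR_conv_of_real field_simps)
  also have "\<dots> = of_real (cmod z)"
    using False by (simp add: complex_norm_square[symmetric] power2_eq_square)
  finally show ?thesis .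
qed simp

text \<open>
  The phase of \<open>u\<close> is a subgradient of the convex function \<open>cmod\<close> at \<open>u\<close>.
\<close>

lemma norm_add_ge_phase:
  "cmod u + t * Re (cnj (phase u) * v) \<le> cmod (u + of_real t * v)"
proof -
  have "cmod u + t * Re (cnj (phase u) * v) = Re (cnj (phase u) * (u + of_real t * v))"
    using arg_cong[OF cnj_phase_mult_self[of u], of Re] by (simp add: algebra_simps)
  also have "\<dots> \<le> cmod (cnj (phase u) * (u + of_real t * v))"
    by (rule complex_Re_le_cmod)
  finally show ?thesis by (simp add: norm_mult)
qed

lemma borel_measurable_phase: "phase \<in> borel_measurable borel"
  unfolding phase_def sgn_div_norm by measurable

lemma borel_measurable_cnj: "cnj \<in> borel_measurable borel"
  by (intro borel_measurable_continuous_onI continuous_intros)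

text \<open>
  A line that stays below a parabola and touches it at the origin is its tangent there.
\<close>

lemma slope_eq_of_quadratic_bound:
  fixes D E Q :: real
  assumes "\<And>t. t * D \<le> t * E + t\<^sup>2 * Q"
  shows "D = E"
proof (rule ccontr)
  assume "D \<noteq> E"
  define t where "t = (D - E) / (2 * (1 + \<bar>Q\<bar>))"
  have t: "t * (2 * (1 + \<bar>Q\<bar>)) = D - E" by (simp add: t_def add_nonneg_eq_0_iff)
  have "t * (D - E) \<le> t\<^sup>2 * Q" using assms[of t] by (simp add: algebra_simps)
  also have "t\<^sup>2 * Q \<le> t\<^sup>2 * \<bar>Q\<bar>" by (intro mult_left_mono) auto
  finally have "t\<^sup>2 * (2 * (1 + \<bar>Q\<bar>)) \<le> t\<^sup>2 * \<bar>Q\<bar>"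
    unfolding t[symmetric] by (simp add: power2_eq_square mult_ac)
  then have "2 * (1 + \<bar>Q\<bar>) \<le> \<bar>Q\<bar> \<or> t = 0" by auto
  then have "t = 0" by (auto simp: abs_if split: if_splits)
  with t \<open>D \<noteq> E\<close> show False by simp
qed

lemma cgauss_eq_linear_form:
  assumes "finite J" "i \<in> J"
  shows "c * cgauss i \<omega> = (\<Sum>k\<in>J. (if k = i then c else 0) * cgauss k \<omega>)"
  using assms by (simp add: if_distrib[of "\<lambda>x. x * _"] cong: if_cong)

lemma integrable_cgauss_norm_power4:
  assumes "finite J" "i \<in> J"
  shows "integrable (gauss (J \<times> UNIV)) (\<lambda>\<omega>. cmod (cgauss i \<omega>) ^ 4)"
proof -
  have Re4: "integrable (gauss (J \<times> UNIV)) (\<lambda>\<omega>. Re (c * cgauss i \<omega>) ^ 4)" for c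
    unfolding cgauss_eq_linear_form[OF assms]
    using cgauss_Re_even_power[OF assms(1), of "\<lambda>k. if k = i then c else 0" 2]
    by (simp add: has_bochner_integral_iff)
  have "integrable (gauss (J \<times> UNIV)) (\<lambda>\<omega>. 2 * (Re (1 * cgauss i \<omega>) ^ 4 + Re (\<i> * cgauss i \<omega>) ^ 4))"
    by (intro integrable_mult_right Bochner_Integration.integrable_add Re4)
  then show ?thesis
  proof (rule Bochner_Integration.integrable_bound)
    show "(\<lambda>\<omega>. cmod (cgauss i \<omega>) ^ 4) \<in> borel_measurable (gauss (J \<times> UNIV))"
      using measurable_cgauss[OF assms(2)] by measurable
    have "cmod z ^ 4 \<le> 2 * (Re z ^ 4 + Im z ^ 4)" for z
    proof -
      have "cmod z ^ 4 = ((Re z)\<^sup>2 + (Im z)\<^sup>2)\<^sup>2"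
        using cmod_power2[of z] by (metis power_mult mult_2_right numeral_Bit0)
      also have "\<dots> \<le> 2 * (((Re z)\<^sup>2)\<^sup>2 + ((Im z)\<^sup>2)\<^sup>2)"
        using sum_squares_bound[of "(Re z)\<^sup>2" "(Im z)\<^sup>2"] by (simp add: power2_sum)
      finally show ?thesis by simp
    qed
    then show "AE \<omega> in gauss (J \<times> UNIV). norm (cmod (cgauss i \<omega>) ^ 4)
        \<le> norm (2 * (Re (1 * cgauss i \<omega>) ^ 4 + Re (\<i> * cgauss i \<omega>) ^ 4))"
      by (auto simp: order.trans[OF _ abs_ge_self])
  qed
qed

text \<open>
  One majorant for all the products of Gaussians and phases whose means or mean squares occur
  below.
\<close>

lemma integrable_cgauss_bound:
  assumes "finite J" "i \<in> J" "k \<in> J"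
    and "f \<in> borel_measurable (gauss (J \<times> UNIV))"
    and "\<And>\<omega>. norm (f \<omega>) \<le> 1 + cmod (cgauss i \<omega>) ^ 4 + cmod (cgauss k \<omega>) ^ 4"
  shows "integrable (gauss (J \<times> UNIV)) (f :: _ \<Rightarrow> 'b :: {banach, second_countable_topology})"
proof -
  interpret prob_space "gauss (J \<times> (UNIV :: bool set))" by (rule prob_space_gauss)
  have "integrable (gauss (J \<times> UNIV)) (\<lambda>\<omega>. 1 + cmod (cgauss i \<omega>) ^ 4 + cmod (cgauss k \<omega>) ^ 4)"
    by (intro Bochner_Integration.integrable_add integrable_cgauss_norm_power4 assms(1-3)) simp
  then show ?thesis
    by (rule Bochner_Integration.integrable_bound) (use assms(4,5) in \<open>auto simp: order.trans[OF _ abs_ge_self]\<close>)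
qed

lemma power_le_one_plus_power4:
  fixes x :: real
  assumes "0 \<le> x" "k \<le> 4"
  shows "x ^ k \<le> 1 + x ^ 4"
proof (cases "x \<le> 1")
  case True
  then have "x ^ k \<le> 1" using assms(1) by (simp add: power_le_one)
  then show ?thesis using assms(1) by (smt (verit) zero_le_power)
next
  case False
  then have "x ^ k \<le> x ^ 4" using assms by (intro power_increasing) auto
  then show ?thesis by simp
qed

text \<open>
  The derivative of \<open>E \<bar>u\<bar> = \<kappa> \<parallel>a\<parallel>\<close> in the coefficient vector \<open>a\<close>, without differentiating
  under the integral: the pointwise subgradient inequality integrates to a linear lower bound
  for \<open>\<kappa>\<close> times the norm of the moved coefficient vector, this norm has a quadratic upper bound
  that agrees with it at the origin, and so both have the same slope.
\<close>

lemma cgauss_phase_expectation: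
  assumes "finite J" "i \<in> J" and unit: "(\<Sum>k\<in>J. (cmod (a k))\<^sup>2) = 1"
  shows "integral\<^sup>L (gauss (J \<times> UNIV))
      (\<lambda>\<omega>. cnj (phase (\<Sum>k\<in>J. a k * cgauss k \<omega>)) * cgauss i \<omega>) = of_real (sqrt (pi / 2)) * cnj (a i)"
proof -
  define G where "G = gauss (J \<times> (UNIV :: bool set))"
  interpret prob_space G unfolding G_def by (rule prob_space_gauss)
  define \<kappa> where "\<kappa> = sqrt (pi / 2)"
  define u where "u \<omega> = (\<Sum>k\<in>J. a k * cgauss k \<omega>)" for \<omega>
  define f where "f \<omega> = cnj (phase (u \<omega>)) * cgauss i \<omega>" for \<omega>
  have u: "u \<in> borel_measurable G"
    unfolding u_def G_def by (rule measurable_cgauss_linear_form)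
  have "(\<lambda>\<omega>. cnj (phase (u \<omega>))) \<in> borel_measurable G"
    by (intro measurable_compose[OF _ borel_measurable_cnj] measurable_compose[OF u borel_measurable_phase])
  moreover have "cgauss i \<in> borel_measurable G"
    unfolding G_def using assms(2) by (rule measurable_cgauss)
  ultimately have f: "f \<in> borel_measurable G"
    unfolding f_def by (rule borel_measurable_times)
  have int_f: "integrable G f"
    unfolding G_def
  proof (rule integrable_cgauss_bound[OF assms(1,2,2)])
    fix \<omega>
    have "norm (f \<omega>) \<le> 1 + cmod (cgauss i \<omega>) ^ 4"
      using power_le_one_plus_power4[of "cmod (cgauss i \<omega>)" 1] by (simp add: f_def norm_mult)
    then show "norm (f \<omega>) \<le> 1 + cmod (cgauss i \<omega>) ^ 4 + cmod (cgauss i \<omega>) ^ 4"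
      by (rule add_increasing2[rotated]) simp
  qed (use f in \<open>simp add: G_def\<close>)
  have Re_int: "Re (c * integral\<^sup>L G f) = Re (c * (of_real \<kappa> * cnj (a i)))" for c
  proof -
    have cf: "integral\<^sup>L G (\<lambda>\<omega>. Re (c * f \<omega>)) = Re (c * integral\<^sup>L G f)"
      using int_f by (subst integral_Re) auto
    have "t * Re (c * integral\<^sup>L G f) \<le> t * (\<kappa> * Re (c * cnj (a i))) + t\<^sup>2 * (\<kappa> * (cmod c)\<^sup>2 / 2)" for t
    proof -
      \<comment> \<open>Moving the \<open>i\<close>-th coefficient in the direction \<open>c\<close>; the directions \<open>1\<close> and \<open>- \<i>\<close> give the
        real and the imaginary part of the expectation.\<close>
      define b where "b k = a k + of_real t * (if k = i then c else 0)" for k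
      have b: "(\<Sum>k\<in>J. b k * cgauss k \<omega>) = u \<omega> + of_real t * (c * cgauss i \<omega>)" for \<omega>
        unfolding cgauss_eq_linear_form[OF assms(1,2)] u_def b_def
        by (simp add: sum.distrib sum_distrib_left algebra_simps)
      have norm_b: "(\<Sum>k\<in>J. (cmod (b k))\<^sup>2) = 1 + 2 * t * Re (c * cnj (a i)) + t\<^sup>2 * (cmod c)\<^sup>2" (is "_ = ?N")
      proof -
        have "(cmod (b k))\<^sup>2 = (cmod (a k))\<^sup>2 + (if k = i then 2 * t * Re (c * cnj (a i)) + t\<^sup>2 * (cmod c)\<^sup>2 else 0)" for k
          unfolding b_def cmod_power2 by (simp add: power2_eq_square algebra_simps)
        then show ?thesis using assms by (simp add: sum.distrib)
      qed
      have N: "0 \<le> ?N" unfolding norm_b[symmetric] by (simp add: sum_nonneg)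
      have E: "has_bochner_integral G u' r \<Longrightarrow> integrable G u' \<and> integral\<^sup>L G u' = r" for u' :: "_ \<Rightarrow> real" and r
        by (simp add: has_bochner_integral_iff)
      have E0: "integrable G (\<lambda>\<omega>. cmod (u \<omega>)) \<and> integral\<^sup>L G (\<lambda>\<omega>. cmod (u \<omega>)) = \<kappa>"
        using E[OF cgauss_norm[OF assms(1), of a, folded G_def u_def]] unit by (simp add: \<kappa>_def)
      have Et: "integrable G (\<lambda>\<omega>. cmod (u \<omega> + of_real t * (c * cgauss i \<omega>))) \<and>
          integral\<^sup>L G (\<lambda>\<omega>. cmod (u \<omega> + of_real t * (c * cgauss i \<omega>))) = \<kappa> * sqrt ?N"
        using E[OF cgauss_norm[OF assms(1), of b, folded G_def]] unfolding b norm_b \<kappa>_def .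
      have "\<kappa> + t * Re (c * integral\<^sup>L G f) = integral\<^sup>L G (\<lambda>\<omega>. cmod (u \<omega>) + t * Re (c * f \<omega>))"
        using E0 int_f by (subst Bochner_Integration.integral_add) (auto simp: cf)
      also have "\<dots> \<le> integral\<^sup>L G (\<lambda>\<omega>. cmod (u \<omega> + of_real t * (c * cgauss i \<omega>)))"
      proof (rule integral_mono)
        show "cmod (u \<omega>) + t * Re (c * f \<omega>) \<le> cmod (u \<omega> + of_real t * (c * cgauss i \<omega>))" for \<omega>
          using norm_add_ge_phase[of "u \<omega>" t "c * cgauss i \<omega>"] by (simp add: f_def mult_ac)
      qed (use E0 Et int_f in auto)
      also have "\<dots> = \<kappa> * sqrt ?N" using Et by simp
      also have "\<dots> \<le> \<kappa> * (1 + t * Re (c * cnj (a i)) + t\<^sup>2 * (cmod c)\<^sup>2 / 2)"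
        using arith_geo_mean_sqrt[of 1 ?N] N by (intro mult_left_mono) (auto simp: \<kappa>_def field_simps)
      finally show ?thesis by (simp add: algebra_simps)
    qed
    from slope_eq_of_quadratic_bound[OF this] show ?thesis by (simp add: algebra_simps)
  qed
  have "integral\<^sup>L G f = of_real \<kappa> * cnj (a i)"
    using Re_int[of 1] Re_int[of "- \<i>"] by (simp add: complex_eq_iff)
  then show ?thesis unfolding f_def[abs_def] u_def G_def \<kappa>_def .
qed

lemma cgauss_norm_square:
  assumes "finite J"
  shows "has_bochner_integral (gauss (J \<times> UNIV)) (\<lambda>\<omega>. (cmod (\<Sum>i\<in>J. a i * cgauss i \<omega>))\<^sup>2)
    (2 * (\<Sum>i\<in>J. (cmod (a i))\<^sup>2))"
proof -
  have Re_sq: "has_bochner_integral (gauss (J \<times> UNIV)) (\<lambda>\<omega>. (Re (\<Sum>i\<in>J. b i * cgauss i \<omega>))\<^sup>2)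
      (\<Sum>i\<in>J. (cmod (b i))\<^sup>2)" for b
    using cgauss_Re_even_power[OF assms, of b 1] by simp
  have rot: "(\<Sum>i\<in>J. - \<i> * a i * cgauss i \<omega>) = - \<i> * (\<Sum>i\<in>J. a i * cgauss i \<omega>)" for \<omega>
    by (simp add: sum_distrib_left mult.assoc)
  have "(cmod (\<Sum>i\<in>J. a i * cgauss i \<omega>))\<^sup>2 =
      (Re (\<Sum>i\<in>J. a i * cgauss i \<omega>))\<^sup>2 + (Re (\<Sum>i\<in>J. - \<i> * a i * cgauss i \<omega>))\<^sup>2" for \<omega>
  proof -
    have "(cmod z)\<^sup>2 = (Re z)\<^sup>2 + (Re (- \<i> * z))\<^sup>2" for z by (simp add: cmod_power2)
    then show ?thesis unfolding rot .
  qed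
  then show ?thesis
    using has_bochner_integral_add[OF Re_sq[of a] Re_sq[of "\<lambda>i. - \<i> * a i"]]
    by (simp add: norm_mult)
qed

text \<open>
  By polarization of \<open>cgauss_norm_square\<close>.
\<close>

lemma cgauss_covariance:
  assumes "finite J" "i \<in> J" "k \<in> J"
  shows "integral\<^sup>L (gauss (J \<times> UNIV)) (\<lambda>\<omega>. cgauss i \<omega> * cnj (cgauss k \<omega>)) = (if i = k then 2 else 0)"
proof -
  define G where "G = gauss (J \<times> (UNIV :: bool set))"
  interpret prob_space G unfolding G_def by (rule prob_space_gauss)
  define f where "f \<omega> = cgauss i \<omega> * cnj (cgauss k \<omega>)" for \<omega>
  have f: "f \<in> borel_measurable G"
    unfolding f_def G_def using assms(2,3)
    by (intro borel_measurable_times measurable_compose[OF _ borel_measurable_cnj] measurable_cgauss)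
  have int_f: "integrable G f"
    unfolding G_def
  proof (rule integrable_cgauss_bound[OF assms])
    fix \<omega>
    have "2 * cmod (f \<omega>) \<le> cmod (cgauss i \<omega>) ^ 2 + cmod (cgauss k \<omega>) ^ 2"
      using sum_squares_bound[of "cmod (cgauss i \<omega>)" "cmod (cgauss k \<omega>)"] by (simp add: f_def norm_mult)
    moreover have "0 \<le> cmod (cgauss i \<omega>) ^ 4" "0 \<le> cmod (cgauss k \<omega>) ^ 4" by auto
    moreover have "(cmod (cgauss j \<omega>))\<^sup>2 \<le> 1 + cmod (cgauss j \<omega>) ^ 4" for j
      by (rule power_le_one_plus_power4) auto
    note this[of i] this[of k]
    ultimately show "norm (f \<omega>) \<le> 1 + cmod (cgauss i \<omega>) ^ 4 + cmod (cgauss k \<omega>) ^ 4"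
      by linarith
  qed (use f in \<open>simp add: G_def\<close>)
  show ?thesis
  proof (cases "i = k")
    case True
    have "f = (\<lambda>\<omega>. of_real ((cmod (\<Sum>j\<in>J. (if j = i then 1 else 0) * cgauss j \<omega>))\<^sup>2))"
      unfolding cgauss_eq_linear_form[OF assms(1,2), symmetric]
      by (rule ext) (simp add: f_def True complex_norm_square del: of_real_power)
    then have "integral\<^sup>L G f = of_real (2 * (\<Sum>j\<in>J. (cmod (if j = i then 1 else 0))\<^sup>2))"
      using cgauss_norm_square[OF assms(1), of "\<lambda>j. if j = i then 1 else 0"]
      by (simp add: has_bochner_integral_iff G_def del: of_real_power of_real_mult)
    then show ?thesis
      unfolding f_def[abs_def] G_def using True assms by (simp add: if_distrib[of cmod] if_distrib[of "\<lambda>x. x ^ _"] cong: if_cong)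
  next
    case False
    have Re_int: "Re (c * integral\<^sup>L G f) = 0" if "cmod c = 1" for c
    proof -
      define Q where "Q b \<omega> = (cmod (\<Sum>j\<in>J. b j * cgauss j \<omega>))\<^sup>2" for b \<omega>
      have Q: "integrable G (Q b)" "integral\<^sup>L G (Q b) = 2 * (\<Sum>j\<in>J. (cmod (b j))\<^sup>2)" for b
        using cgauss_norm_square[OF assms(1), of b] by (auto simp: Q_def[abs_def] has_bochner_integral_iff G_def)
      define b where "b j = (if j = i then c else 0) + (if j = k then 1 else 0)" for j
      define b' where "b' j = (if j = i then c else 0) + (if j = k then - 1 else 0)" for j
      have "4 * Re (c * f \<omega>) = Q b \<omega> - Q b' \<omega>" for \<omega>
      proof -
        have forms: "(\<Sum>j\<in>J. b j * cgauss j \<omega>) = c * cgauss i \<omega> + 1 * cgauss k \<omega>"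
          "(\<Sum>j\<in>J. b' j * cgauss j \<omega>) = c * cgauss i \<omega> + (- 1) * cgauss k \<omega>"
          unfolding cgauss_eq_linear_form[OF assms(1,2)] cgauss_eq_linear_form[OF assms(1,3)] b_def b'_def
          by (simp_all only: distrib_right sum.distrib)
        show ?thesis
          unfolding Q_def forms f_def cmod_power2 by (simp add: power2_eq_square algebra_simps)
      qed
      moreover have "(cmod (b j))\<^sup>2 = (cmod (b' j))\<^sup>2" for j
        using False by (simp add: b_def b'_def)
      ultimately have "integral\<^sup>L G (\<lambda>\<omega>. 4 * Re (c * f \<omega>)) = 0"
        using Q by simp
      moreover have "integral\<^sup>L G (\<lambda>\<omega>. Re (c * f \<omega>)) = Re (c * integral\<^sup>L G f)"
        using int_f by (subst integral_Re) auto
      ultimately show ?thesis by (simp del: times_complex.sel)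
    qed
    have "integral\<^sup>L G f = 0"
      using Re_int[of 1] Re_int[of "- \<i>"] by (simp add: complex_eq_iff)
    then show ?thesis unfolding f_def[abs_def] G_def using False by simp
  qed
qed

section \<open>Finite samples that reproduce expectations\<close>

lemma (in prob_space) ex_le_expectation:
  fixes h :: "'a \<Rightarrow> real"
  assumes "integrable M h"
  shows "\<exists>x\<in>space M. h x \<le> expectation h"
proof (rule ccontr)
  assume "\<not> ?thesis"
  then have "AE x in M. expectation h < h x" by (auto simp: not_le)
  then have "expectation (\<lambda>_. expectation h) < expectation h"
    using assms by (intro integral_less_AE_space) (auto simp: emeasure_space_1)
  then show False by (simp add: prob_space)
qed

text \<open>
  The sample is chosen greedily. If \<open>S\<close> is the vector of the sums of the centred functions over
  the points chosen so far, the expectation of the squared norm of \<open>S + F(x)\<close> is the squared norm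
  of \<open>S\<close> plus the total variance \<open>V\<close>, so some \<open>x\<close> raises the squared norm by at most \<open>V\<close>. After
  \<open>q\<close> steps it is at most \<open>q V\<close>, and the averages deviate by at most the root of \<open>V / q\<close>.
\<close>

lemma (in prob_space) ex_sample_close_to_expectations:
  fixes f :: "'r \<Rightarrow> 'a \<Rightarrow> complex" and \<eta> :: real
  assumes "finite R"
    and meas: "\<And>r. r \<in> R \<Longrightarrow> f r \<in> borel_measurable M"
    and sq: "\<And>r. r \<in> R \<Longrightarrow> integrable M (\<lambda>x. (cmod (f r x))\<^sup>2)"
    and "0 < \<eta>"
  shows "\<exists>xs. xs \<noteq> [] \<and> set xs \<subseteq> space M \<and>
    (\<forall>r\<in>R. cmod ((\<Sum>x\<leftarrow>xs. f r x) - of_nat (length xs) * expectation (f r)) \<le> \<eta> * length xs)"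
proof -
  have int: "integrable M (f r)" if "r \<in> R" for r
  proof -
    have "integrable M (\<lambda>x. 1 + (cmod (f r x))\<^sup>2)"
      using sq[OF that] by simp
    then show ?thesis
    proof (rule Bochner_Integration.integrable_bound[OF _ meas[OF that]])
      have "y \<le> 1 + y\<^sup>2" for y :: real
      proof -
        have "2 * y \<le> 1 + y\<^sup>2" using sum_squares_bound[of 1 y] by simp
        moreover have "0 \<le> 1 + y\<^sup>2" by simp
        ultimately show ?thesis by linarith
      qed
      then show "AE x in M. norm (f r x) \<le> norm (1 + (cmod (f r x))\<^sup>2)"
        by (auto simp: order.trans[OF _ abs_ge_self])
    qed
  qed
  define F where "F r x = f r x - expectation (f r)" for r x
  define V where "V = (\<Sum>r\<in>R. expectation (\<lambda>x. (cmod (F r x))\<^sup>2))"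
  have F: "integrable M (F r)" "expectation (F r) = 0" "integrable M (\<lambda>x. (cmod (F r x))\<^sup>2)" if "r \<in> R" for r
  proof -
    show iF: "integrable M (F r)"
      unfolding F_def using int[OF that] by simp
    show "expectation (F r) = 0"
      unfolding F_def using int[OF that] by (simp add: prob_space)
    have "integrable M (\<lambda>x. 2 * ((cmod (f r x))\<^sup>2 + (cmod (expectation (f r)))\<^sup>2))"
      using sq[OF that] by simp
    then show "integrable M (\<lambda>x. (cmod (F r x))\<^sup>2)"
    proof (rule Bochner_Integration.integrable_bound)
      have "(cmod (a - b))\<^sup>2 \<le> 2 * ((cmod a)\<^sup>2 + (cmod b)\<^sup>2)" for a b
      proof -
        have "(cmod (a - b))\<^sup>2 \<le> (cmod a + cmod b)\<^sup>2"
          by (intro power_mono norm_triangle_ineq4) simp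
        also have "\<dots> \<le> 2 * ((cmod a)\<^sup>2 + (cmod b)\<^sup>2)"
          using sum_squares_bound[of "cmod a" "cmod b"] by (simp add: power2_sum)
        finally show ?thesis .
      qed
      then show "AE x in M. norm ((cmod (F r x))\<^sup>2) \<le> norm (2 * ((cmod (f r x))\<^sup>2 + (cmod (expectation (f r)))\<^sup>2))"
        by (auto simp: F_def order.trans[OF _ abs_ge_self])
    qed (use iF in \<open>auto dest: borel_measurable_integrable\<close>)
  qed
  have "\<exists>xs. length xs = q \<and> set xs \<subseteq> space M \<and> (\<Sum>r\<in>R. (cmod (\<Sum>x\<leftarrow>xs. F r x))\<^sup>2) \<le> q * V" for q :: nat
  proof (induction q)
    case (Suc q)
    then obtain xs where xs: "length xs = q" "set xs \<subseteq> space M"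
      and le: "(\<Sum>r\<in>R. (cmod (\<Sum>x\<leftarrow>xs. F r x))\<^sup>2) \<le> q * V" by blast
    define S where "S r = (\<Sum>x\<leftarrow>xs. F r x)" for r
    define h where "h x = (\<Sum>r\<in>R. (cmod (S r))\<^sup>2 + 2 * Re (cnj (S r) * F r x) + (cmod (F r x))\<^sup>2)" for x
    have Re_int: "integrable M (\<lambda>x. Re (cnj (S r) * F r x))" "expectation (\<lambda>x. Re (cnj (S r) * F r x)) = 0"
      if "r \<in> R" for r
      using F(1,2)[OF that] by (auto simp: integral_Re simp del: times_complex.sel)
    have "integrable M h"
      unfolding h_def by (intro Bochner_Integration.integrable_sum Bochner_Integration.integrable_add)
        (use F Re_int in auto)
    then obtain x where x: "x \<in> space M" "h x \<le> expectation h"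
      using ex_le_expectation by blast
    have "expectation h = (\<Sum>r\<in>R. (cmod (S r))\<^sup>2) + V"
      unfolding h_def V_def using F Re_int by (simp add: sum.distrib prob_space del: times_complex.sel)
    with x(2) le have "h x \<le> Suc q * V"
      by (simp add: S_def algebra_simps)
    moreover have "h x = (\<Sum>r\<in>R. (cmod (\<Sum>x\<leftarrow>x # xs. F r x))\<^sup>2)"
      unfolding h_def S_def[symmetric] list.map sum_list.Cons
      unfolding cmod_power2 by (intro sum.cong) (auto simp: power2_eq_square algebra_simps)
    ultimately show ?case
      using xs x(1) by (intro exI[of _ "x # xs"]) auto
  qed auto
  note sample = this
  obtain q :: nat where "max 1 (V / \<eta>\<^sup>2) < q"
    using reals_Archimedean2 by blast
  then have q: "0 < q" "V / \<eta>\<^sup>2 \<le> q" by auto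
  obtain xs where xs: "length xs = q" "set xs \<subseteq> space M"
    and le: "(\<Sum>r\<in>R. (cmod (\<Sum>x\<leftarrow>xs. F r x))\<^sup>2) \<le> q * V"
    using sample[of q] by blast
  have "cmod ((\<Sum>x\<leftarrow>xs. f r x) - of_nat (length xs) * expectation (f r)) \<le> \<eta> * length xs" if "r \<in> R" for r
  proof -
    have diff: "(\<Sum>x\<leftarrow>xs. f r x) - of_nat (length xs) * expectation (f r) = (\<Sum>x\<leftarrow>xs. F r x)"
      unfolding F_def by (simp add: sum_list_subtractf sum_list_triv)
    have "(cmod (\<Sum>x\<leftarrow>xs. F r x))\<^sup>2 \<le> (\<eta> * q)\<^sup>2"
    proof -
      have "(cmod (\<Sum>x\<leftarrow>xs. F r x))\<^sup>2 \<le> (\<Sum>r\<in>R. (cmod (\<Sum>x\<leftarrow>xs. F r x))\<^sup>2)"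
        using assms(1) that by (intro member_le_sum) auto
      also have "\<dots> \<le> q * V" by (rule le)
      also have "\<dots> \<le> q * (q * \<eta>\<^sup>2)"
        using q \<open>0 < \<eta>\<close> by (intro mult_left_mono) (auto simp: field_simps)
      finally show ?thesis by (simp add: power2_eq_square mult_ac)
    qed
    then have "cmod (\<Sum>x\<leftarrow>xs. F r x) \<le> \<eta> * q"
      by (rule power2_le_imp_le) (use \<open>0 < \<eta>\<close> in simp)
    then show ?thesis unfolding diff by (simp add: xs(1))
  qed
  then show ?thesis using xs q(1) by (intro exI[of _ xs]) auto
qed

section \<open>Approximate averages of unimodular multiples\<close>

text \<open>
  The sample is drawn from \<open>c = g / \<kappa>\<close> and the conjugate phases of the forms with coefficients
  \<open>cnj y\<^sub>j\<^sub>i\<close>, as explained at the beginning.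
\<close>

lemma ex_approximate_averages:
  fixes y :: "nat \<Rightarrow> nat \<Rightarrow> complex" and \<eta> :: real
  assumes "\<And>j. j < N \<Longrightarrow> (\<Sum>i<m. (cmod (y j i))\<^sup>2) \<le> 1" and "0 < \<eta>"
  shows "\<exists>L. L \<noteq> [] \<and> (\<forall>s\<in>set L. \<forall>j. cmod (snd s j) = 1) \<and>
    (\<forall>j<N. \<forall>i<m. cmod ((\<Sum>s\<leftarrow>L. fst s i * snd s j) - of_nat (length L) * y j i) \<le> \<eta> * length L) \<and>
    (\<forall>i<m. \<forall>k<m. cmod ((\<Sum>s\<leftarrow>L. fst s i * cnj (fst s k)) -
      of_nat (length L) * (if i = k then of_real (4 / pi) else 0)) \<le> \<eta> * length L)"
proof -
  define J where "J = {..m}"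
  define G where "G = gauss (J \<times> (UNIV :: bool set))"
  interpret prob_space G unfolding G_def by (rule prob_space_gauss)
  have J: "finite J" by (simp add: J_def)
  define \<kappa> where "\<kappa> = sqrt (pi / 2)"
  have \<kappa>: "1 \<le> \<kappa>" "\<kappa>\<^sup>2 = pi / 2" using pi_ge_two by (auto simp: \<kappa>_def)
  \<comment> \<open>The coordinate with index \<open>m\<close> completes the vector to length one. It influences the phases,
    but only the coordinates below \<open>m\<close> enter the statement.\<close>
  define a where "a j i = (if i < m then cnj (y j i) else of_real (sqrt (1 - (\<Sum>i<m. (cmod (y j i))\<^sup>2))))" for j i
  have a: "(\<Sum>i\<in>J. (cmod (a j i))\<^sup>2) = 1" if "j < N" for j
    unfolding J_def lessThan_Suc_atMost[symmetric] using assms(1)[OF that] by (simp add: a_def)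
  define z where "z j \<omega> = cnj (phase (\<Sum>i\<in>J. a j i * cgauss i \<omega>))" for j \<omega>
  have z_norm: "cmod (z j \<omega>) = 1" for j \<omega> by (simp add: z_def)
  have z_meas: "z j \<in> borel_measurable G" for j
    unfolding z_def G_def
    by (intro measurable_compose[OF _ borel_measurable_cnj]
        measurable_compose[OF measurable_cgauss_linear_form borel_measurable_phase])
  have g_meas: "cgauss i \<in> borel_measurable G" if "i < m" for i
    unfolding G_def using that by (intro measurable_cgauss) (simp add: J_def)
  define f where "f r \<omega> = (case r of Inl (j, i) \<Rightarrow> z j \<omega> * cgauss i \<omega> | Inr (i, k) \<Rightarrow> cgauss i \<omega> * cnj (cgauss k \<omega>))"
    for r :: "nat \<times> nat + nat \<times> nat" and \<omega>
  define R where "R = ({..<N} \<times> {..<m}) <+> ({..<m} \<times> {..<m})"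
  have meas: "f r \<in> borel_measurable G" if "r \<in> R" for r
    using that unfolding R_def f_def
    by (auto intro!: borel_measurable_times z_meas g_meas measurable_compose[OF _ borel_measurable_cnj])
  have sq: "integrable G (\<lambda>\<omega>. (cmod (f r \<omega>))\<^sup>2)" if r: "r \<in> R" for r
  proof -
    have meas2: "(\<lambda>\<omega>. (cmod (f r \<omega>))\<^sup>2) \<in> borel_measurable (gauss (J \<times> UNIV))"
      using meas[OF r] unfolding G_def by (intro borel_measurable_power measurable_compose[OF _ borel_measurable_norm])
    show ?thesis
    proof (cases r)
      case (Inl p)
      then obtain j i where [simp]: "r = Inl (j, i)" and i: "i \<in> J" using r by (auto simp: R_def J_def)
      show ?thesis unfolding G_def
      proof (rule integrable_cgauss_bound[OF J i i meas2])
        fix \<omega>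
        have "norm ((cmod (f r \<omega>))\<^sup>2) \<le> 1 + cmod (cgauss i \<omega>) ^ 4"
          using power_le_one_plus_power4[of "cmod (cgauss i \<omega>)" 2] by (simp add: f_def norm_mult z_norm)
        then show "norm ((cmod (f r \<omega>))\<^sup>2) \<le> 1 + cmod (cgauss i \<omega>) ^ 4 + cmod (cgauss i \<omega>) ^ 4"
          by (rule add_increasing2[rotated]) simp
      qed
    next
      case (Inr p)
      then obtain i k where [simp]: "r = Inr (i, k)" and ik: "i \<in> J" "k \<in> J" using r by (auto simp: R_def J_def)
      show ?thesis unfolding G_def
      proof (rule integrable_cgauss_bound[OF J ik meas2])
        fix \<omega>
        have "2 * (cmod (f r \<omega>))\<^sup>2 \<le> cmod (cgauss i \<omega>) ^ 4 + cmod (cgauss k \<omega>) ^ 4"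
          using sum_squares_bound[of "(cmod (cgauss i \<omega>))\<^sup>2" "(cmod (cgauss k \<omega>))\<^sup>2"]
          by (simp add: f_def norm_mult power_mult_distrib flip: power_mult)
        moreover have "0 \<le> cmod (cgauss i \<omega>) ^ 4" "0 \<le> cmod (cgauss k \<omega>) ^ 4" by auto
        moreover have "norm ((cmod (f r \<omega>))\<^sup>2) = (cmod (f r \<omega>))\<^sup>2" by simp
        ultimately show "norm ((cmod (f r \<omega>))\<^sup>2) \<le> 1 + cmod (cgauss i \<omega>) ^ 4 + cmod (cgauss k \<omega>) ^ 4"
          by linarith
      qed
    qed
  qed
  have "finite R" by (simp add: R_def)
  have "\<exists>xs. xs \<noteq> [] \<and> set xs \<subseteq> space G \<and>
      (\<forall>r\<in>R. cmod ((\<Sum>x\<leftarrow>xs. f r x) - of_nat (length xs) * expectation (f r)) \<le> \<eta> * length xs)"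
    by (rule ex_sample_close_to_expectations) (fact \<open>finite R\<close> meas sq \<open>0 < \<eta>\<close>)+
  then
  obtain xs where xs: "xs \<noteq> []" and
    close': "\<forall>r\<in>R. cmod ((\<Sum>x\<leftarrow>xs. f r x) - of_nat (length xs) * expectation (f r)) \<le> \<eta> * length xs"
    by (elim exE conjE) (rule that)
  note close = bspec[OF close']
  have shrink: "cmod (A / of_real t - of_nat q * (B / of_real t)) \<le> \<eta> * q"
    if "1 \<le> t" "cmod (A - of_nat q * B) \<le> \<eta> * q" for A B :: complex and t :: real and q :: nat
  proof -
    have "A / of_real t - of_nat q * (B / of_real t) = (A - of_nat q * B) / of_real t"
      by (simp add: diff_divide_distrib)
    then have "cmod (A / of_real t - of_nat q * (B / of_real t)) = cmod (A - of_nat q * B) / t"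
      using that(1) by (simp add: norm_divide)
    also have "\<dots> \<le> cmod (A - of_nat q * B)"
      using that(1) by (simp add: divide_le_eq mult_le_cancel_left1)
    finally show ?thesis using that(2) by simp
  qed
  define L where "L = map (\<lambda>\<omega>. (\<lambda>i. cgauss i \<omega> / of_real \<kappa>, \<lambda>j. z j \<omega>)) xs"
  have scale: "(\<Sum>\<omega>\<leftarrow>xs. h \<omega> / c) = (\<Sum>\<omega>\<leftarrow>xs. h \<omega>) / c" for h :: "_ \<Rightarrow> complex" and c
    by (induction xs) (auto simp: add_divide_distrib)
  have "cmod ((\<Sum>s\<leftarrow>L. fst s i * snd s j) - of_nat (length L) * y j i) \<le> \<eta> * length L" if "j < N" "i < m" for j i
  proof -
    have "expectation (f (Inl (j, i))) = of_real \<kappa> * y j i"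
      using cgauss_phase_expectation[OF J, of i "a j"] a[OF that(1)] that(2)
      by (simp add: f_def[abs_def] z_def G_def \<kappa>_def a_def J_def)
    then have "expectation (f (Inl (j, i))) / of_real \<kappa> = y j i"
      using \<kappa>(1) by simp
    moreover have "(\<Sum>s\<leftarrow>L. fst s i * snd s j) = (\<Sum>x\<leftarrow>xs. f (Inl (j, i)) x) / of_real \<kappa>"
      by (simp add: L_def o_def f_def mult.commute flip: scale)
    moreover have "Inl (j, i) \<in> R" using that by (auto simp: R_def)
    ultimately show ?thesis
      using shrink[OF \<kappa>(1) close[of "Inl (j, i)"]] by (simp add: L_def)
  qed
  moreover have "cmod ((\<Sum>s\<leftarrow>L. fst s i * cnj (fst s k)) -
      of_nat (length L) * (if i = k then of_real (4 / pi) else 0)) \<le> \<eta> * length L" if "i < m" "k < m" for i k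
  proof -
    have "expectation (f (Inr (i, k))) = (if i = k then 2 else 0)"
      using cgauss_covariance[OF J, of i k] that by (simp add: f_def[abs_def] G_def J_def)
    then have "expectation (f (Inr (i, k))) / of_real (\<kappa>\<^sup>2) = (if i = k then of_real (4 / pi) else 0)"
      unfolding \<kappa>(2) by (simp add: field_simps)
    moreover have "(\<Sum>s\<leftarrow>L. fst s i * cnj (fst s k)) = (\<Sum>x\<leftarrow>xs. f (Inr (i, k)) x) / of_real (\<kappa>\<^sup>2)"
      by (simp add: L_def o_def f_def power2_eq_square flip: scale)
    moreover have "1 \<le> \<kappa>\<^sup>2" using \<kappa>(1) by simp
    moreover have "Inr (i, k) \<in> R" using that by (auto simp: R_def)
    ultimately show ?thesis
      using shrink[OF _ close[of "Inr (i, k)"], of "\<kappa>\<^sup>2"] by (simp add: L_def del: of_real_power)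
  qed
  ultimately show ?thesis
    using xs by (intro exI[of _ L]) (auto simp: L_def z_norm)
qed

section \<open>Exact averages of unimodular multiples\<close>

lemma sum_list_sum_swap:
  "(\<Sum>x\<leftarrow>xs. \<Sum>i\<in>A. f i x) = (\<Sum>i\<in>A. \<Sum>x\<leftarrow>xs. f i x)"
  by (induction xs) (simp_all add: sum.distrib)

lemma sum_list_concat_replicate:
  "(\<Sum>x\<leftarrow>concat (replicate q xs). f x) = of_nat q * (\<Sum>x\<leftarrow>xs. f x :: 'a :: comm_semiring_1)"
  by (induction q) (simp_all add: algebra_simps)

lemma sum_list_concat_map_upt:
  "(\<Sum>x\<leftarrow>concat (map P [0..<N]). f x) = (\<Sum>j<N. \<Sum>x\<leftarrow>P j. f x)"
  by (induction N) (simp_all add: add.commute)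

lemma of_real_sum_list: "of_real (\<Sum>x\<leftarrow>xs. f x) = (\<Sum>x\<leftarrow>xs. of_real (f x))"
  by (induction xs) simp_all

lemma sum_norm_square_le:
  "(\<Sum>i<m. cmod (v i))\<^sup>2 \<le> real m * (\<Sum>i<m. (cmod (v i))\<^sup>2)"
  using sum_squared_le_sum_of_squares[of "\<lambda>i. cmod (v i)" "{..<m}"] by (simp add: mult.commute)

text \<open>
  The quadratic form of the matrix \<open>\<Sum> c c*\<close>, where \<open>c\<close> runs through the first components of the
  list.
\<close>

definition frame_form :: "nat \<Rightarrow> ((nat \<Rightarrow> complex) \<times> 'b) list \<Rightarrow> (nat \<Rightarrow> complex) \<Rightarrow> real" where
  "frame_form m L v = (\<Sum>s\<leftarrow>L. (cmod (\<Sum>i<m. cnj (fst s i) * v i))\<^sup>2)"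

lemma frame_form_eq:
  fixes L :: "((nat \<Rightarrow> complex) \<times> 'b) list"
  shows "of_real (frame_form m L v) = (\<Sum>i<m. \<Sum>k<m. cnj (v i) * v k * (\<Sum>s\<leftarrow>L. fst s i * cnj (fst s k)))"
proof -
  have "of_real ((cmod (\<Sum>i<m. cnj (fst s i) * v i))\<^sup>2) =
      (\<Sum>i<m. \<Sum>k<m. cnj (v i) * v k * (fst s i * cnj (fst s k)))" for s :: "(nat \<Rightarrow> complex) \<times> 'b"
  proof -
    have "of_real ((cmod w)\<^sup>2) = cnj w * w" for w
      by (simp add: complex_norm_square mult.commute del: of_real_power)
    note this[of "\<Sum>i<m. cnj (fst s i) * v i"]
    also have "cnj (\<Sum>i<m. cnj (fst s i) * v i) = (\<Sum>i<m. fst s i * cnj (v i))" by simp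
    also have "\<dots> * (\<Sum>k<m. cnj (fst s k) * v k) = (\<Sum>i<m. \<Sum>k<m. cnj (v i) * v k * (fst s i * cnj (fst s k)))"
      unfolding sum_product by (intro sum.cong refl) (simp add: mult_ac)
    finally show ?thesis .
  qed
  then show ?thesis
    unfolding frame_form_def of_real_sum_list
    by (simp add: sum_list_sum_swap sum_list_const_mult del: of_real_power)
qed

text \<open>
  Entries within \<open>\<delta>\<close> of those of \<open>t\<close> times the identity change the quadratic form by at most
  \<open>\<delta> (\<Sum> \<bar>v\<^sub>i\<bar>)\<^sup>2\<close>, and the Cauchy-Schwarz inequality costs the factor \<open>m\<close>.
\<close>

lemma frame_form_near_tight:
  assumes "\<And>i k. i < m \<Longrightarrow> k < m \<Longrightarrow>
    cmod ((\<Sum>s\<leftarrow>L. fst s i * cnj (fst s k)) - (if i = k then of_real t else 0)) \<le> \<delta>"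
  shows "\<bar>frame_form m L v - t * (\<Sum>i<m. (cmod (v i))\<^sup>2)\<bar> \<le> \<delta> * real m * (\<Sum>i<m. (cmod (v i))\<^sup>2)"
proof (cases "m = 0")
  case False
  define A where "A i k = (\<Sum>s\<leftarrow>L. fst s i * cnj (fst s k))" for i k
  have "0 \<le> \<delta>" using assms[of 0 0] False by (meson norm_ge_zero order_trans neq0_conv)
  have diag: "of_real (t * (\<Sum>i<m. (cmod (v i))\<^sup>2)) =
      (\<Sum>i<m. \<Sum>k<m. cnj (v i) * v k * (if i = k then of_real t else 0))"
    by (simp add: if_distrib[of "\<lambda>x. _ * x"] complex_norm_square sum_distrib_left mult_ac
        cong: if_cong del: of_real_power)
  have "complex_of_real (frame_form m L v - t * (\<Sum>i<m. (cmod (v i))\<^sup>2)) =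
      (\<Sum>i<m. \<Sum>k<m. cnj (v i) * v k * (A i k - (if i = k then of_real t else 0)))"
    unfolding of_real_diff frame_form_eq diag A_def by (simp add: sum_subtractf right_diff_distrib)
  then have "\<bar>frame_form m L v - t * (\<Sum>i<m. (cmod (v i))\<^sup>2)\<bar> =
      cmod (\<Sum>i<m. \<Sum>k<m. cnj (v i) * v k * (A i k - (if i = k then of_real t else 0)))"
    by (metis norm_of_real)
  also have "\<dots> \<le> (\<Sum>i<m. \<Sum>k<m. cmod (v i) * cmod (v k) * \<delta>)"
  proof (intro order.trans[OF norm_sum] sum_mono)
    fix i k assume "i \<in> {..<m}" "k \<in> {..<m}"
    then show "cmod (cnj (v i) * v k * (A i k - (if i = k then of_real t else 0))) \<le> cmod (v i) * cmod (v k) * \<delta>"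
      unfolding norm_mult complex_mod_cnj A_def by (intro mult_left_mono assms) auto
  qed
  also have "\<dots> = \<delta> * (\<Sum>i<m. cmod (v i))\<^sup>2"
    by (simp add: power2_eq_square sum_product sum_distrib_left mult_ac)
  also have "\<dots> \<le> \<delta> * (real m * (\<Sum>i<m. (cmod (v i))\<^sup>2))"
    using \<open>0 \<le> \<delta>\<close> by (intro mult_left_mono sum_norm_square_le)
  finally show ?thesis by (simp add: mult_ac)
qed (simp add: frame_form_def)

text \<open>
  Two pairs whose phases differ at \<open>j\<close> only and whose vectors are opposite: their contributions
  cancel for every other index and add up to \<open>e\<close> at \<open>j\<close>.
\<close>

definition column_bump :: "(nat \<Rightarrow> complex) \<Rightarrow> nat \<Rightarrow> ((nat \<Rightarrow> complex) \<times> (nat \<Rightarrow> complex)) list" where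
  "column_bump e j = [(\<lambda>i. e i / 2, \<lambda>_. 1), (\<lambda>i. - (e i / 2), \<lambda>k. if k = j then - 1 else 1)]"

lemma sum_column_bump:
  "(\<Sum>s\<leftarrow>column_bump e j. fst s i * snd s k) = (if k = j then e i else 0)"
  by (simp add: column_bump_def)

lemma frame_form_column_bump_le:
  assumes "\<And>i. i < m \<Longrightarrow> cmod (e i) \<le> B"
  shows "frame_form m (column_bump e j) v \<le> B\<^sup>2 * real m / 2 * (\<Sum>i<m. (cmod (v i))\<^sup>2)"
proof (cases "m = 0")
  case False
  then have "0 \<le> B" using assms[of 0] by (meson norm_ge_zero order_trans neq0_conv)
  define S where "S = (\<Sum>i<m. cnj (e i) * v i)"
  have half: "(\<Sum>i<m. cnj (e i / 2) * v i) = S / 2" "(\<Sum>i<m. cnj (- (e i / 2)) * v i) = - (S / 2)"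
    by (simp_all add: S_def sum_divide_distrib sum_negf)
  have "frame_form m (column_bump e j) v = (cmod S)\<^sup>2 / 2"
    unfolding frame_form_def column_bump_def list.map sum_list.Cons sum_list.Nil fst_conv half
    by (simp add: norm_divide power_divide)
  also have "cmod S \<le> B * (\<Sum>i<m. cmod (v i))"
    unfolding S_def sum_distrib_left using assms
    by (intro order.trans[OF norm_sum] sum_mono) (auto simp: norm_mult intro!: mult_right_mono)
  then have "(cmod S)\<^sup>2 / 2 \<le> (B * (\<Sum>i<m. cmod (v i)))\<^sup>2 / 2"
    by (intro divide_right_mono power_mono) auto
  also have "\<dots> \<le> B\<^sup>2 * (real m * (\<Sum>i<m. (cmod (v i))\<^sup>2)) / 2"
    unfolding power_mult_distrib by (intro divide_right_mono mult_left_mono sum_norm_square_le) auto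
  finally show ?thesis by simp
qed (simp add: frame_form_def)

text \<open>
  An approximating list of length \<open>q\<close> is repeated \<open>s\<close> times, and the bumps for all \<open>j < N\<close> are
  repeated \<open>q\<close> times, so that the total length is \<open>q (s + 2 N)\<close>. The vector \<open>e j\<close> that makes
  the average for \<open>j\<close> exact is then bounded by \<open>2 N + 1\<close>, independently of \<open>s\<close>, if the
  approximation is good to within \<open>1 / s\<close>. Hence the bumps contribute at most a constant \<open>K\<close>
  times \<open>q\<close> to the quadratic form, which is negligible against \<open>q s\<close> for large \<open>s\<close>.
\<close>

lemma ex_exact_averages:
  fixes y :: "nat \<Rightarrow> nat \<Rightarrow> complex" and \<epsilon> :: real
  assumes y: "\<And>j. j < N \<Longrightarrow> (\<Sum>i<m. (cmod (y j i))\<^sup>2) \<le> 1"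
    and "0 < \<epsilon>" "\<epsilon> < 1"
  shows "\<exists>L. L \<noteq> [] \<and> (\<forall>s\<in>set L. \<forall>j. cmod (snd s j) = 1) \<and>
    (\<forall>j<N. \<forall>i<m. (\<Sum>s\<leftarrow>L. fst s i * snd s j) = of_nat (length L) * y j i) \<and>
    (\<forall>v. (1 - \<epsilon>)\<^sup>2 * length L * (\<Sum>i<m. (cmod (v i))\<^sup>2) \<le> frame_form m L v \<and>
         frame_form m L v \<le> 4 / pi * (1 + \<epsilon>)\<^sup>2 * length L * (\<Sum>i<m. (cmod (v i))\<^sup>2))"
proof -
  define K where "K = real N * ((2 * real N + 1)\<^sup>2 * real m / 2)"
  have "0 \<le> K" by (simp add: K_def)
  \<comment> \<open>With \<open>4 N \<le> \<epsilon> s\<close> the \<open>2 N\<close> extra entries per \<open>s\<close> sampled ones lower the average by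
    at most a factor that the square of \<open>1 - \<epsilon>\<close> allows; with \<open>K \<le> \<epsilon> s\<close> the bumps raise it by at most \<open>\<epsilon>\<close>.\<close>
  obtain s :: nat where "(4 * real N + K + 1) / \<epsilon> < s" using reals_Archimedean2 by blast
  then have "4 * real N + K + 1 < \<epsilon> * s" using \<open>0 < \<epsilon>\<close> by (simp add: field_simps)
  then have s_pos: "0 < s" and s_N: "4 * real N \<le> \<epsilon> * s" and s_K: "K \<le> \<epsilon> * s"
    using \<open>0 \<le> K\<close> by (auto intro: Nat.gr0I)
  define \<eta> where "\<eta> = min (1 / s) (\<epsilon> / (2 * real (Suc m)))"
  have "0 < \<eta>" using s_pos \<open>0 < \<epsilon>\<close> by (simp add: \<eta>_def)
  have s_eta: "s * \<eta> \<le> 1" 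
    using s_pos by (simp add: \<eta>_def min_def field_simps)
  have "\<eta> * real m \<le> \<epsilon> / (2 * real (Suc m)) * real (Suc m)"
    using \<open>0 < \<epsilon>\<close> by (intro mult_mono) (auto simp: \<eta>_def)
  also have "\<dots> = \<epsilon> / 2" by (simp del: of_nat_Suc)
  finally have m_eta: "\<eta> * real m \<le> \<epsilon> / 2" .
  have "\<exists>L. L \<noteq> [] \<and> (\<forall>s\<in>set L. \<forall>j. cmod (snd s j) = 1) \<and>
    (\<forall>j<N. \<forall>i<m. cmod ((\<Sum>s\<leftarrow>L. fst s i * snd s j) - of_nat (length L) * y j i) \<le> \<eta> * length L) \<and>
    (\<forall>i<m. \<forall>k<m. cmod ((\<Sum>s\<leftarrow>L. fst s i * cnj (fst s k)) -
      of_nat (length L) * (if i = k then of_real (4 / pi) else 0)) \<le> \<eta> * length L)"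
    by (rule ex_approximate_averages) (fact y \<open>0 < \<eta>\<close>)+
  then obtain L0 where L0: "L0 \<noteq> []" "\<forall>s\<in>set L0. \<forall>j. cmod (snd s j) = 1"
    and avg': "\<forall>j<N. \<forall>i<m.
      cmod ((\<Sum>s\<leftarrow>L0. fst s i * snd s j) - of_nat (length L0) * y j i) \<le> \<eta> * length L0"
    and cov': "\<forall>i<m. \<forall>k<m. cmod ((\<Sum>s\<leftarrow>L0. fst s i * cnj (fst s k)) -
      of_nat (length L0) * (if i = k then of_real (4 / pi) else 0)) \<le> \<eta> * length L0"
    by (elim exE conjE) (rule that)
  note avg = avg'[rule_format] and cov = cov'[rule_format]
  define q where "q = length L0"
  have "0 < q" using L0 by (simp add: q_def)
  define W where "W j i = (\<Sum>s\<leftarrow>L0. fst s i * snd s j)" for j i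
  \<comment> \<open>The solution of \<open>s * W j + q * e j = q * (s + 2 * N) * y j\<close>.\<close>
  define e where "e j i = 2 * of_nat N * y j i + of_nat s * (of_nat q * y j i - W j i) / of_nat q" for j i
  have e_le: "cmod (e j i) \<le> 2 * real N + 1" if "j < N" "i < m" for j i
  proof -
    have "(cmod (y j i))\<^sup>2 \<le> (\<Sum>i<m. (cmod (y j i))\<^sup>2)"
      using that(2) by (intro member_le_sum) auto
    also have "\<dots> \<le> 1\<^sup>2" using y[OF that(1)] by simp
    finally have "cmod (y j i) \<le> 1" by (rule power2_le_imp_le) simp
    then have "2 * real N * cmod (y j i) \<le> 2 * real N * 1" by (intro mult_left_mono) auto
    moreover have "real s * cmod (of_nat q * y j i - W j i) / real q \<le> real s * (\<eta> * real q) / real q"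
      using avg[OF that] by (intro divide_right_mono mult_left_mono) (auto simp: W_def q_def norm_minus_commute)
    ultimately show ?thesis
      using norm_triangle_ineq[of "2 * of_nat N * y j i" "of_nat s * (of_nat q * y j i - W j i) / of_nat q"]
        s_eta \<open>0 < q\<close> by (simp add: e_def norm_mult norm_divide)
  qed
  define P where "P = concat (map (\<lambda>j. column_bump (e j) j) [0..<N])"
  define L where "L = concat (replicate s L0) @ concat (replicate q P)"
  have "length P = 2 * N"
    by (simp add: P_def column_bump_def length_concat sum_list_triv o_def)
  then have len: "length L = q * (s + 2 * N)"
    by (simp add: L_def length_concat sum_list_replicate q_def algebra_simps)
  then have "L \<noteq> []" using \<open>0 < q\<close> s_pos by auto
  moreover have "\<forall>s\<in>set L. \<forall>j. cmod (snd s j) = 1"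
    using L0(2) by (auto simp: L_def P_def column_bump_def)
  moreover have "(\<Sum>s\<leftarrow>L. fst s i * snd s j) = of_nat (length L) * y j i" if "j < N" "i < m" for j i
  proof -
    have "(\<Sum>s\<leftarrow>P. fst s i * snd s j) = e j i"
      unfolding P_def sum_list_concat_map_upt sum_column_bump using that(1) by simp
    then have "(\<Sum>s\<leftarrow>L. fst s i * snd s j) = of_nat s * W j i + of_nat q * e j i"
      by (simp add: L_def sum_list_concat_replicate W_def)
    also have "of_nat q * e j i = of_nat q * (2 * of_nat N * y j i) + of_nat s * (of_nat q * y j i - W j i)"
      using \<open>0 < q\<close> by (simp add: e_def distrib_left)
    finally show ?thesis by (simp add: len algebra_simps)
  qed
  moreover have "(1 - \<epsilon>)\<^sup>2 * length L * V \<le> frame_form m L v \<and>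
      frame_form m L v \<le> 4 / pi * (1 + \<epsilon>)\<^sup>2 * length L * V"
    if V_def: "V = (\<Sum>i<m. (cmod (v i))\<^sup>2)" for v V
  proof -
    have V: "0 \<le> V" by (simp add: V_def sum_nonneg)
    have form: "frame_form m L v = s * frame_form m L0 v + q * frame_form m P v"
      by (simp add: frame_form_def L_def sum_list_concat_replicate)
    have "cmod ((\<Sum>s\<leftarrow>L0. fst s i * cnj (fst s k)) - (if i = k then of_real (q * (4 / pi)) else 0)) \<le> \<eta> * q"
      if "i < m" "k < m" for i k
      using cov[OF that] by (simp add: q_def if_distrib[of "\<lambda>x. _ * x"] cong: if_cong)
    from frame_form_near_tight[OF this, where v = v]
    have "\<bar>frame_form m L0 v - q * (4 / pi) * V\<bar> \<le> \<eta> * m * (q * V)"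
      by (simp add: V_def mult_ac)
    also have "\<dots> \<le> \<epsilon> / 2 * (q * V)"
      using m_eta V by (intro mult_right_mono) auto
    finally have near: "\<bar>frame_form m L0 v - q * (4 / pi) * V\<bar> \<le> \<epsilon> / 2 * (q * V)" .
    have sample: "frame_form m L0 v \<le> (4 / pi + \<epsilon> / 2) * (q * V)"
        "(4 / pi - \<epsilon> / 2) * (q * V) \<le> frame_form m L0 v"
    proof -
      have "(4 / pi + \<epsilon> / 2) * (q * V) = q * (4 / pi) * V + \<epsilon> / 2 * (q * V)"
        "(4 / pi - \<epsilon> / 2) * (q * V) = q * (4 / pi) * V - \<epsilon> / 2 * (q * V)"
        by (simp_all add: algebra_simps)
      moreover have "f \<le> a + b \<and> a - b \<le> f" if "\<bar>f - a\<bar> \<le> b" for f a b :: real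
        using that by linarith
      note this[OF near]
      ultimately show "frame_form m L0 v \<le> (4 / pi + \<epsilon> / 2) * (q * V)"
        "(4 / pi - \<epsilon> / 2) * (q * V) \<le> frame_form m L0 v" by metis+
    qed
    have P_nonneg: "0 \<le> frame_form m P v"
      unfolding frame_form_def by (rule sum_list_nonneg) auto
    have "frame_form m P v = (\<Sum>j<N. frame_form m (column_bump (e j) j) v)"
      unfolding frame_form_def P_def sum_list_concat_map_upt ..
    also have "\<dots> \<le> (\<Sum>j<N. (2 * real N + 1)\<^sup>2 * real m / 2 * V)"
      unfolding V_def using e_le by (intro sum_mono frame_form_column_bump_le) auto
    also have "\<dots> = K * V" by (simp add: K_def)
    also have "\<dots> \<le> \<epsilon> * s * V" using s_K V by (intro mult_right_mono)
    finally have P_le: "frame_form m P v \<le> \<epsilon> * s * V" .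
    have "(1 - \<epsilon>)\<^sup>2 * length L * V \<le> s * ((4 / pi - \<epsilon> / 2) * (q * V))"
    proof -
      have "(1 - \<epsilon>)\<^sup>2 * (s + 2 * real N) \<le> (1 - \<epsilon>) * (s + 2 * real N)"
        using \<open>0 < \<epsilon>\<close> \<open>\<epsilon> < 1\<close> by (intro mult_right_mono) (auto simp: power2_eq_square mult_le_cancel_left1)
      also have "\<dots> \<le> (1 - \<epsilon> / 2) * s"
      proof -
        have "0 \<le> \<epsilon> * real N" using \<open>0 < \<epsilon>\<close> by simp
        then show ?thesis using s_N by (simp add: algebra_simps)
      qed
      also have "\<dots> \<le> (4 / pi - \<epsilon> / 2) * s"
        using pi_less_4 by (intro mult_right_mono) auto
      finally have "(1 - \<epsilon>)\<^sup>2 * (s + 2 * real N) * (q * V) \<le> (4 / pi - \<epsilon> / 2) * s * (q * V)"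
        using V by (intro mult_right_mono) auto
      then show ?thesis by (simp add: len mult_ac)
    qed
    also have "\<dots> \<le> s * frame_form m L0 v"
      using sample(2) by (intro mult_left_mono) auto
    also have "\<dots> \<le> frame_form m L v"
      unfolding form using P_nonneg by simp
    finally have lower: "(1 - \<epsilon>)\<^sup>2 * length L * V \<le> frame_form m L v" .
    have "frame_form m L v \<le> s * ((4 / pi + \<epsilon> / 2) * (q * V)) + q * (\<epsilon> * s * V)"
      unfolding form using sample(1) P_le by (intro add_mono mult_left_mono) auto
    also have "\<dots> = (4 / pi + 3 / 2 * \<epsilon>) * (q * s * V)"
      by (simp add: algebra_simps)
    also have "\<dots> \<le> (4 / pi * (1 + \<epsilon>)\<^sup>2) * (q * (s + 2 * real N) * V)"
    proof (intro mult_mono mult_left_mono mult_right_mono)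
      have "1 \<le> 4 / pi" using pi_less_4 by simp
      then have "2 * \<epsilon> \<le> 4 / pi * (2 * \<epsilon>)" using mult_right_mono[of 1 "4 / pi" "2 * \<epsilon>"] \<open>0 < \<epsilon>\<close> by simp
      moreover have "0 \<le> 4 / pi * \<epsilon>\<^sup>2" by simp
      moreover have "4 / pi * (1 + \<epsilon>)\<^sup>2 = 4 / pi + 4 / pi * (2 * \<epsilon>) + 4 / pi * \<epsilon>\<^sup>2"
        by (simp add: power2_sum distrib_left)
      ultimately show "4 / pi + 3 / 2 * \<epsilon> \<le> 4 / pi * (1 + \<epsilon>)\<^sup>2"
        using \<open>0 < \<epsilon>\<close> by linarith
    qed (use V in \<open>auto intro!: mult_left_mono\<close>)
    also have "\<dots> = 4 / pi * (1 + \<epsilon>)\<^sup>2 * length L * V"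
      by (simp add: len mult_ac)
    finally show ?thesis using lower by simp
  qed
  ultimately show ?thesis by (intro exI[of _ L]) auto
qed

section \<open>Loewner bounds for products with the adjoint\<close>

lemma mat_adjoint_carrier:
  assumes "A \<in> carrier_mat r c"
  shows "mat_adjoint A \<in> carrier_mat c r"
  using carrier_matD[OF assms] by (intro carrier_matI) (simp_all add: mat_adjoint_def)

lemma index_mat_adjoint:
  assumes "A \<in> carrier_mat r c" "i < c" "j < r"
  shows "mat_adjoint A $$ (i, j) = cnj (A $$ (j, i))"
proof -
  have dims: "dim_row A = r" "dim_col A = c" using assms(1) by auto
  have "mat_adjoint A $$ (i, j) = map conjugate (cols A) ! i $ j"
    unfolding mat_adjoint_def using assms(2,3) dims by (subst mat_of_rows_index) auto
  also have "\<dots> = conjugate (col A i) $ j"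
    using assms(2) dims by simp
  also have "\<dots> = cnj (A $$ (j, i))"
    using assms(2,3) dims by simp
  finally show ?thesis .
qed

lemma index_mult_mat_adjoint:
  assumes "C \<in> carrier_mat m l" "i < m" "j < m"
  shows "(C * mat_adjoint C) $$ (i, j) = (\<Sum>k<l. C $$ (i, k) * cnj (C $$ (j, k)))"
proof -
  have dims: "dim_row C = m" "dim_col C = l" "dim_row (mat_adjoint C) = l" "dim_col (mat_adjoint C) = m"
    using assms(1) mat_adjoint_carrier[OF assms(1)] by auto
  have "(C * mat_adjoint C) $$ (i, j) = (\<Sum>k\<in>{0..<l}. C $$ (i, k) * mat_adjoint C $$ (k, j))"
    using assms(2,3) dims by (simp add: scalar_prod_def)
  also have "\<dots> = (\<Sum>k<l. C $$ (i, k) * cnj (C $$ (j, k)))"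
    unfolding atLeast0LessThan using assms(3) by (intro sum.cong) (auto simp: index_mat_adjoint[OF assms(1)])
  finally show ?thesis .
qed

text \<open>
  The quadratic form of \<open>C C*\<close> at \<open>v\<close> is the squared norm of \<open>w = C* v\<close>.
\<close>

lemma adjoint_quadratic_form:
  assumes C: "C \<in> carrier_mat m l" and v: "v \<in> carrier_vec m"
  shows "((C * mat_adjoint C) *\<^sub>v v) \<bullet>c v =
    of_real (\<Sum>k<l. (cmod (\<Sum>i<m. cnj (C $$ (i, k)) * v $ i))\<^sup>2)"
proof -
  define w where "w = mat_adjoint C *\<^sub>v v"
  have w: "w \<in> carrier_vec l" unfolding w_def using mat_adjoint_carrier[OF C] v by simp
  have w_index: "w $ k = (\<Sum>i<m. cnj (C $$ (i, k)) * v $ i)" if "k < l" for k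
    unfolding w_def using mat_adjoint_carrier[OF C] v that C
    by (simp add: scalar_prod_def index_mat_adjoint[OF C] atLeast0LessThan)
  have "((C * mat_adjoint C) *\<^sub>v v) \<bullet>c v = (C *\<^sub>v w) \<bullet>c v"
    unfolding w_def using assoc_mult_mat_vec[OF C mat_adjoint_carrier[OF C] v] by simp
  also have "\<dots> = (\<Sum>i<m. (\<Sum>k<l. C $$ (i, k) * w $ k) * cnj (v $ i))"
    using C v w by (simp add: scalar_prod_def atLeast0LessThan)
  also have "\<dots> = (\<Sum>k<l. \<Sum>i<m. C $$ (i, k) * w $ k * cnj (v $ i))"
    unfolding sum_distrib_right by (rule sum.swap)
  also have "\<dots> = (\<Sum>k<l. w $ k * cnj (w $ k))"
  proof (rule sum.cong)
    fix k assume "k \<in> {..<l}"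
    then have "cnj (w $ k) = (\<Sum>i<m. C $$ (i, k) * cnj (v $ i))" by (simp add: w_index)
    then show "(\<Sum>i<m. C $$ (i, k) * w $ k * cnj (v $ i)) = w $ k * cnj (w $ k)"
      by (simp only: sum_distrib_left) (simp only: mult_ac)
  qed simp
  also have "\<dots> = of_real (\<Sum>k<l. (cmod (w $ k))\<^sup>2)"
    by (simp only: complex_norm_square of_real_sum)
  also have "(\<Sum>k<l. (cmod (w $ k))\<^sup>2) = (\<Sum>k<l. (cmod (\<Sum>i<m. cnj (C $$ (i, k)) * v $ i))\<^sup>2)"
    by (rule sum.cong) (simp_all only: w_index lessThan_iff)
  finally show ?thesis .
qed

lemma scalar_quadratic_form:
  assumes v: "v \<in> carrier_vec m"
  shows "((of_real a \<cdot>\<^sub>m 1\<^sub>m m) *\<^sub>v v) \<bullet>c v = of_real (a * (\<Sum>i<m. (cmod (v $ i))\<^sup>2))"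
proof -
  have "(of_real a \<cdot>\<^sub>m 1\<^sub>m m) *\<^sub>v v = of_real a \<cdot>\<^sub>v v"
  proof (rule eq_vecI)
    fix i assume "i < dim_vec (of_real a \<cdot>\<^sub>v v)"
    then have i: "i < m" using v by simp
    have "((of_real a \<cdot>\<^sub>m 1\<^sub>m m) *\<^sub>v v) $ i = (\<Sum>k<m. of_real a * (if k = i then 1 else 0) * v $ k)"
      using i v by (simp add: scalar_prod_def atLeast0LessThan)
    also have "\<dots> = (\<Sum>k<m. if k = i then of_real a * v $ k else 0)"
      by (intro sum.cong) auto
    finally show "((of_real a \<cdot>\<^sub>m 1\<^sub>m m) *\<^sub>v v) $ i = (of_real a \<cdot>\<^sub>v v) $ i"
      using i v by simp
  qed (use v in simp)
  moreover have "(of_real a \<cdot>\<^sub>v v) \<bullet>c v = (\<Sum>i<m. of_real a * (v $ i * cnj (v $ i)))"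
    using v by (simp add: scalar_prod_def atLeast0LessThan mult.assoc)
  ultimately show ?thesis
    by (simp add: complex_norm_square sum_distrib_left del: of_real_power)
qed

lemma loewner_leI:
  assumes A: "A \<in> carrier_mat m m" and B: "B \<in> carrier_mat m m"
    and "\<And>i j. i < m \<Longrightarrow> j < m \<Longrightarrow> A $$ (i, j) = cnj (A $$ (j, i))"
    and "\<And>i j. i < m \<Longrightarrow> j < m \<Longrightarrow> B $$ (i, j) = cnj (B $$ (j, i))"
    and le: "\<And>v. v \<in> carrier_vec m \<Longrightarrow> (A *\<^sub>v v) \<bullet>c v \<le> (B *\<^sub>v v) \<bullet>c v"
  shows "A \<le>\<^sub>L B"
proof -
  have D: "B - A \<in> carrier_mat m m" by (rule minus_carrier_mat[OF A])
  have "mat_adjoint (B - A) = B - A"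
  proof (rule eq_matI)
    fix i j assume "i < dim_row (B - A)" "j < dim_col (B - A)"
    then have ij: "i < m" "j < m"
      using carrier_matD[OF D] by (simp_all del: index_minus_mat(2,3))
    have "mat_adjoint (B - A) $$ (i, j) = cnj ((B - A) $$ (j, i))"
      by (rule index_mat_adjoint[OF D ij])
    also have "\<dots> = cnj (B $$ (j, i)) - cnj (A $$ (j, i))"
      using carrier_matD[OF A] carrier_matD[OF B] ij by simp
    also have "\<dots> = (B - A) $$ (i, j)"
      unfolding assms(3)[OF ij, symmetric] assms(4)[OF ij, symmetric] using carrier_matD[OF A] carrier_matD[OF B] ij by simp
    finally show "mat_adjoint (B - A) $$ (i, j) = (B - A) $$ (i, j)" .
  qed (simp_all add: carrier_matD[OF D] carrier_matD[OF mat_adjoint_carrier[OF D]] del: index_minus_mat(2,3))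
  moreover have "0 \<le> ((B - A) *\<^sub>v v) \<bullet>c v" if v: "v \<in> carrier_vec m" for v
  proof -
    have "((B - A) *\<^sub>v v) \<bullet>c v = (B *\<^sub>v v - A *\<^sub>v v) \<bullet>c v"
      unfolding minus_mult_distrib_mat_vec[OF B A v] ..
    also have "\<dots> = (B *\<^sub>v v) \<bullet>c v - (A *\<^sub>v v) \<bullet>c v"
      by (rule minus_scalar_prod_distrib[OF mult_mat_vec_carrier[OF B v]
          mult_mat_vec_carrier[OF A v] carrier_vec_conjugate[OF v]])
    finally show ?thesis using le[OF v] by simp
  qed
  ultimately show ?thesis
    using carrier_matD[OF A] carrier_matD[OF B] carrier_matD[OF D]
    unfolding loewner_le_def psd_def square_mat.simps by (intro conjI ballI) simp_all
qed

text \<open>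
  The vectors are plain functions here, which matches the form in which the bounds on the list of
  pairs are available.
\<close>

lemma loewner_le_mult_adjoint:
  assumes C: "C \<in> carrier_mat m l"
  shows "(\<And>v. a * (\<Sum>i<m. (cmod (v i))\<^sup>2) \<le> (\<Sum>k<l. (cmod (\<Sum>i<m. cnj (C $$ (i, k)) * v i))\<^sup>2)) \<Longrightarrow>
      of_real a \<cdot>\<^sub>m 1\<^sub>m m \<le>\<^sub>L C * mat_adjoint C"
    and "(\<And>v. (\<Sum>k<l. (cmod (\<Sum>i<m. cnj (C $$ (i, k)) * v i))\<^sup>2) \<le> b * (\<Sum>i<m. (cmod (v i))\<^sup>2)) \<Longrightarrow>
      C * mat_adjoint C \<le>\<^sub>L of_real b \<cdot>\<^sub>m 1\<^sub>m m"
proof -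
  have CC: "C * mat_adjoint C \<in> carrier_mat m m" by (rule mult_carrier_mat[OF C mat_adjoint_carrier[OF C]])
  have herm_C: "(C * mat_adjoint C) $$ (i, j) = cnj ((C * mat_adjoint C) $$ (j, i))" if "i < m" "j < m" for i j
    using that by (simp add: index_mult_mat_adjoint[OF C] mult.commute)
  have herm_I: "(complex_of_real a \<cdot>\<^sub>m 1\<^sub>m m) $$ (i, j) = cnj ((complex_of_real a \<cdot>\<^sub>m 1\<^sub>m m) $$ (j, i))" if "i < m" "j < m" for i j a
    using that by simp
  show "of_real a \<cdot>\<^sub>m 1\<^sub>m m \<le>\<^sub>L C * mat_adjoint C"
    if "\<And>v. a * (\<Sum>i<m. (cmod (v i))\<^sup>2) \<le> (\<Sum>k<l. (cmod (\<Sum>i<m. cnj (C $$ (i, k)) * v i))\<^sup>2)"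
    by (rule loewner_leI[OF _ CC herm_I herm_C])
      (use that in \<open>simp_all only: smult_carrier_mat one_carrier_mat adjoint_quadratic_form[OF C] scalar_quadratic_form less_eq_complex_def Re_complex_of_real Im_complex_of_real\<close>)
  show "C * mat_adjoint C \<le>\<^sub>L of_real b \<cdot>\<^sub>m 1\<^sub>m m"
    if "\<And>v. (\<Sum>k<l. (cmod (\<Sum>i<m. cnj (C $$ (i, k)) * v i))\<^sup>2) \<le> b * (\<Sum>i<m. (cmod (v i))\<^sup>2)"
    by (rule loewner_leI[OF CC _ herm_C herm_I])
      (use that in \<open>simp_all only: smult_carrier_mat one_carrier_mat adjoint_quadratic_form[OF C] scalar_quadratic_form less_eq_complex_def Re_complex_of_real Im_complex_of_real\<close>)
qed

section \<open>Factorization through unimodular matrices\<close>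

lemma sum_column_norm_square_le_one:
  assumes "X \<in> carrier_mat m n" "col_norm X \<le> 1" "j < n"
  shows "(\<Sum>i<m. (cmod (X $$ (i, j)))\<^sup>2) \<le> 1"
proof -
  have "vec_l2_norm (col X j) \<le> col_norm X"
    unfolding col_norm_def using assms(3) carrier_matD[OF assms(1)] by (intro Max_ge finite_imageI imageI) simp_all
  then have "sqrt (\<Sum>i<m. (cmod (X $$ (i, j)))\<^sup>2) \<le> col_norm X"
    using assms(3) carrier_matD[OF assms(1)] by (simp add: vec_l2_norm_def L2_set_def)
  then have "sqrt (\<Sum>i<m. (cmod (X $$ (i, j)))\<^sup>2) \<le> 1"
    using assms(2) by (rule order.trans)
  then show ?thesis by simp
qed

theorem theorem2p5:
  fixes X :: "complex mat" and m n :: nat and \<epsilon> :: real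
  assumes "0 < m" and "0 < n"
    and "X \<in> carrier_mat m n"
    and "col_norm X \<le> 1"
    and "0 < \<epsilon>" and "\<epsilon> < 1"
  shows "\<exists>l::nat. 0 < l \<and> (\<exists>C \<in> carrier_mat m l.
      complex_of_real ((1 - \<epsilon>)\<^sup>2) \<cdot>\<^sub>m 1\<^sub>m m \<le>\<^sub>L C * mat_adjoint C \<and>
      C * mat_adjoint C \<le>\<^sub>L complex_of_real (kGC * (1 + \<epsilon>)\<^sup>2) \<cdot>\<^sub>m 1\<^sub>m m \<and>
      (\<exists>ZX \<in> unimodular_mat l n.
         X = complex_of_real (real l powr (- 1 / 2)) \<cdot>\<^sub>m (C * ZX)) \<and>
      (\<exists>ZI \<in> unimodular_mat l m.
         1\<^sub>m m = complex_of_real (real l powr (- 1 / 2)) \<cdot>\<^sub>m (C * ZI)))"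
proof -
  define y where "y j i = (if j < n then X $$ (i, j) else 1\<^sub>m m $$ (i, j - n))" for j i
  have y: "(\<Sum>i<m. (cmod (y j i))\<^sup>2) \<le> 1" if "j < n + m" for j
  proof (cases "j < n")
    case True
    then show ?thesis using sum_column_norm_square_le_one[OF assms(3,4) True] by (simp add: y_def)
  next
    case False
    then have "(\<Sum>i<m. (cmod (y j i))\<^sup>2) = (\<Sum>i<m. if i = j - n then 1 else 0)"
      using that by (intro sum.cong) (auto simp: y_def)
    then show ?thesis using False that by simp
  qed
  have "\<exists>L. L \<noteq> [] \<and> (\<forall>s\<in>set L. \<forall>j. cmod (snd s j) = 1) \<and>
    (\<forall>j<n + m. \<forall>i<m. (\<Sum>s\<leftarrow>L. fst s i * snd s j) = of_nat (length L) * y j i) \<and>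
    (\<forall>v. (1 - \<epsilon>)\<^sup>2 * length L * (\<Sum>i<m. (cmod (v i))\<^sup>2) \<le> frame_form m L v \<and>
         frame_form m L v \<le> 4 / pi * (1 + \<epsilon>)\<^sup>2 * length L * (\<Sum>i<m. (cmod (v i))\<^sup>2))"
    by (rule ex_exact_averages) (fact y assms(5,6))+
  then obtain L :: "((nat \<Rightarrow> complex) \<times> (nat \<Rightarrow> complex)) list"
    where "L \<noteq> []" and unimodular: "\<forall>s\<in>set L. \<forall>j. cmod (snd s j) = 1"
    and avg: "\<forall>j<n + m. \<forall>i<m. (\<Sum>s\<leftarrow>L. fst s i * snd s j) = of_nat (length L) * y j i"
    and frame: "\<forall>v. (1 - \<epsilon>)\<^sup>2 * length L * (\<Sum>i<m. (cmod (v i))\<^sup>2) \<le> frame_form m L v \<and>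
         frame_form m L v \<le> 4 / pi * (1 + \<epsilon>)\<^sup>2 * length L * (\<Sum>i<m. (cmod (v i))\<^sup>2)"
    by (elim exE conjE) (rule that)
  define l where "l = length L"
  have l: "0 < l" using \<open>L \<noteq> []\<close> by (simp add: l_def)
  define C where "C = Matrix.mat m l (\<lambda>(i, k). fst (L ! k) i / of_real (sqrt l))"
  have C: "C \<in> carrier_mat m l" by (simp add: C_def)
  \<comment> \<open>The \<open>p\<close> columns of phases that start at position \<open>d\<close>: \<open>Z n 0\<close> belongs to \<open>X\<close>, and \<open>Z m n\<close> to
    the identity matrix.\<close>
  define Z where "Z p d = Matrix.mat l p (\<lambda>(k, j). snd (L ! k) (d + j))" for p d
  have list_sum: "(\<Sum>s\<leftarrow>L. h s) = (\<Sum>k<l. h (L ! k))" for h :: "_ \<Rightarrow> 'a :: comm_monoid_add"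
    by (simp add: sum_list_sum_nth l_def atLeast0LessThan)
  have "(\<Sum>k<l. (cmod (\<Sum>i<m. cnj (C $$ (i, k)) * v i))\<^sup>2) = frame_form m L v / l" for v
  proof -
    have "(\<Sum>i<m. cnj (C $$ (i, k)) * v i) = (\<Sum>i<m. cnj (fst (L ! k) i) * v i) / of_real (sqrt l)"
      if "k < l" for k
      using that by (simp add: C_def sum_divide_distrib)
    then have "(cmod (\<Sum>i<m. cnj (C $$ (i, k)) * v i))\<^sup>2 = (cmod (\<Sum>i<m. cnj (fst (L ! k) i) * v i))\<^sup>2 / l"
      if "k < l" for k
      using that by (simp add: norm_divide power_divide)
    then show ?thesis
      unfolding frame_form_def list_sum sum_divide_distrib by (intro sum.cong) auto
  qed
  note form = this
  have lower: "complex_of_real ((1 - \<epsilon>)\<^sup>2) \<cdot>\<^sub>m 1\<^sub>m m \<le>\<^sub>L C * mat_adjoint C"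
  proof (rule loewner_le_mult_adjoint(1)[OF C])
    show "(1 - \<epsilon>)\<^sup>2 * (\<Sum>i<m. (cmod (v i))\<^sup>2) \<le> (\<Sum>k<l. (cmod (\<Sum>i<m. cnj (C $$ (i, k)) * v i))\<^sup>2)" for v
      using spec[OF frame, of v] l unfolding form l_def[symmetric] by (simp add: pos_le_divide_eq mult_ac)
  qed
  have upper: "C * mat_adjoint C \<le>\<^sub>L complex_of_real (kGC * (1 + \<epsilon>)\<^sup>2) \<cdot>\<^sub>m 1\<^sub>m m"
  proof (rule loewner_le_mult_adjoint(2)[OF C])
    show "(\<Sum>k<l. (cmod (\<Sum>i<m. cnj (C $$ (i, k)) * v i))\<^sup>2) \<le> kGC * (1 + \<epsilon>)\<^sup>2 * (\<Sum>i<m. (cmod (v i))\<^sup>2)" for v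
      using spec[OF frame, of v] l unfolding form l_def[symmetric] kGC_def
      by (simp add: pos_divide_le_eq mult_ac)
  qed
  have Z: "Z p d \<in> unimodular_mat l p" for p d
    using unimodular by (auto simp: unimodular_mat_def Z_def elements_mat_def l_def)
  have CZ: "(of_real (real l powr (- 1 / 2)) \<cdot>\<^sub>m (C * Z p d)) $$ (i, j) = y (d + j) i"
    if "i < m" "j < p" "d + p \<le> n + m" for p d i j
  proof -
    have "(C * Z p d) $$ (i, j) = (\<Sum>k<l. fst (L ! k) i * snd (L ! k) (d + j)) / of_real (sqrt l)"
      using that by (simp add: C_def Z_def scalar_prod_def atLeast0LessThan sum_divide_distrib)
    also have "\<dots> = of_nat l * y (d + j) i / of_real (sqrt l)"
      unfolding list_sum[symmetric, of "\<lambda>s. fst s i * snd s (d + j)"] using avg that by (simp add: l_def)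
    finally have entry: "(C * Z p d) $$ (i, j) = of_nat l * y (d + j) i / of_real (sqrt l)" .
    have "real l powr (- 1 / 2) = inverse (real l powr (1 / 2))"
      using powr_minus[of "real l" "1 / 2"] by simp
    also have "\<dots> = inverse (sqrt l)"
      by (simp add: powr_half_sqrt)
    finally have scale: "complex_of_real (real l powr (- 1 / 2)) = inverse (of_real (sqrt l))"
      by (simp only: of_real_inverse)
    have "complex_of_real (sqrt l) * of_real (sqrt l) = of_real (sqrt l * sqrt l)"
      by (simp only: of_real_mult)
    also have "\<dots> = of_nat l" by simp
    finally have square: "of_nat l = complex_of_real (sqrt l) * of_real (sqrt l)" ..
    have "complex_of_real (sqrt l) \<noteq> 0" using l by simp
    then have cancel: "inverse (complex_of_real (sqrt l)) * (of_nat l * z / of_real (sqrt l)) = z" for z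
      unfolding square by simp
    have "(of_real (real l powr (- 1 / 2)) \<cdot>\<^sub>m (C * Z p d)) $$ (i, j) =
        of_real (real l powr (- 1 / 2)) * (C * Z p d) $$ (i, j)"
      by (rule index_smult_mat(1)) (simp_all add: C_def Z_def that)
    then show ?thesis
      unfolding entry scale cancel .
  qed
  have "X = of_real (real l powr (- 1 / 2)) \<cdot>\<^sub>m (C * Z n 0)"
  proof (rule eq_matI)
    fix i j
    assume "i < dim_row (of_real (real l powr (- 1 / 2)) \<cdot>\<^sub>m (C * Z n 0))"
      "j < dim_col (of_real (real l powr (- 1 / 2)) \<cdot>\<^sub>m (C * Z n 0))"
    then have "i < m" "j < n" by (auto simp: C_def Z_def)
    then show "X $$ (i, j) = (of_real (real l powr (- 1 / 2)) \<cdot>\<^sub>m (C * Z n 0)) $$ (i, j)"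
      by (subst CZ) (auto simp: y_def)
  qed (use assms(3) in \<open>auto simp: C_def Z_def\<close>)
  moreover have "1\<^sub>m m = of_real (real l powr (- 1 / 2)) \<cdot>\<^sub>m (C * Z m n)"
  proof (rule eq_matI)
    fix i j
    assume "i < dim_row (of_real (real l powr (- 1 / 2)) \<cdot>\<^sub>m (C * Z m n))"
      "j < dim_col (of_real (real l powr (- 1 / 2)) \<cdot>\<^sub>m (C * Z m n))"
    then have "i < m" "j < m" by (auto simp: C_def Z_def)
    then show "1\<^sub>m m $$ (i, j) = (of_real (real l powr (- 1 / 2)) \<cdot>\<^sub>m (C * Z m n)) $$ (i, j)"
      by (subst CZ) (auto simp: y_def)
  qed (auto simp: C_def Z_def)
  ultimately show ?thesis
    using l C lower upper Z by blast
qed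

end
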